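(* For all integers $k,N$ with $1\leq k<N$ there is a complete, closed, $k$-dimensional complex submanifold of $\mathbb{B}_N$.
   Context: $\mathbb{B}_N$ is the open unit ball of $\mathbb{C}^N$ and $|\cdot|$ is the Euclidean norm. Submanifolds are nonempty and embedded; "closed" means closed as a subset of $\mathbb{B}_N$; dimension is complex dimension. A closed complex submanifold $M$ of $\mathbb{B}_N$ is called complete if every path (continuous map) $p\colon[0,1)\to M$ such that $|p(t)|\to 1$ as $t\to 1$ has infinite length. *)

theory Defs
  imports "HOL-Analysis.Analysis"
begin

text \<open>
  Complex Euclidean space of dimension N is rendered as \<open>complex ^ 'n\<close> with \<open>CARD('n) = N\<close>; its
  library norm is the Euclidean norm, so the open unit ball is \<open>ball 0 1\<close>. Complex scalar
  multiplication is \<open>(*s)\<close>, and \<open>vec.subspace\<close>, \<open>vec.dim\<close> are the complex notions (the plain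
  \<open>subspace\<close>, \<open>dim\<close> would be the real ones).
\<close>

definition holomorphic_map_on :: "(complex ^ 'n \<Rightarrow> complex ^ 'm) \<Rightarrow> (complex ^ 'n) set \<Rightarrow> bool"
  where "holomorphic_map_on f U \<longleftrightarrow>
    (\<forall>z\<in>U. \<exists>D. (f has_derivative D) (at z) \<and> Vector_Spaces.linear (*s) (*s) D)"

definition biholomorphism :: "(complex ^ 'n) set \<Rightarrow> (complex ^ 'n) set \<Rightarrow>
    (complex ^ 'n \<Rightarrow> complex ^ 'n) \<Rightarrow> (complex ^ 'n \<Rightarrow> complex ^ 'n) \<Rightarrow> bool"
  where "biholomorphism U V \<Phi> \<Psi> \<longleftrightarrow>
    open U \<and> open V \<and> homeomorphism U V \<Phi> \<Psi> \<and>
    holomorphic_map_on \<Phi> U \<and> holomorphic_map_on \<Psi> V"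

text \<open>Nonempty embedded complex submanifolds of pure complex dimension \<open>k\<close>, not necessarily
  connected: near each of its points, \<open>M\<close> is flattened onto a complex subspace by a holomorphic
  change of coordinates of the ambient space.\<close>

definition complex_submanifold :: "nat \<Rightarrow> (complex ^ 'n) set \<Rightarrow> bool"
  where "complex_submanifold k M \<longleftrightarrow>
    M \<noteq> {} \<and>
    (\<forall>z\<in>M. \<exists>U V \<Phi> \<Psi> L. z \<in> U \<and> biholomorphism U V \<Phi> \<Psi> \<and>
        vec.subspace L \<and> vec.dim L = k \<and> \<Phi> ` (M \<inter> U) = L \<inter> V)"

definition closed_submanifold_of_ball :: "nat \<Rightarrow> (complex ^ 'n) set \<Rightarrow> bool"
  where "closed_submanifold_of_ball k M \<longleftrightarrow>
    complex_submanifold k M \<and> M \<subseteq> ball 0 1 \<and> closedin (top_of_set (ball 0 1)) M"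

text \<open>Supremum of the lengths of inscribed polygons, over all finite partitions
  \<open>t\<^sub>0 \<le> t\<^sub>1 \<le> \<dots> \<le> t\<^sub>m\<close> of points of \<open>I\<close>.\<close>

definition path_length :: "real set \<Rightarrow> (real \<Rightarrow> 'a::metric_space) \<Rightarrow> ennreal"
  where "path_length I p =
    (SUP ts \<in> {ts. sorted ts \<and> set ts \<subseteq> I}.
       \<Sum>i<length ts - 1. ennreal (dist (p (ts ! i)) (p (ts ! Suc i))))"

definition complete_in_ball :: "(complex ^ 'n) set \<Rightarrow> bool"
  where "complete_in_ball M \<longleftrightarrow>
    (\<forall>p. continuous_on {0..<1} p \<and> p ` {0..<1} \<subseteq> M \<and>
         ((\<lambda>t. norm (p t)) \<longlongrightarrow> 1) (at_left (1::real)) \<longrightarrow>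
         path_length {0..<1} p = \<infinity>)"

end

(*
  Following Globevnik, one constructs a holomorphic function f on the ball that is unbounded on every
  path of finite length ending on the sphere; then every level set of f is complete.
  The obstacles are discs T_a = {z. Re <z,a> = s_j, |z - s_j a| <= r_j} tangent to the spheres of radius
  s_j -> 1, arranged in layers; the other discs of the layer and all earlier ones lie strictly below
  the real hyperplane through T_a. So C_j exp (K_j (<z,a> - s_j)) has modulus C_j on T_a and is tiny on
  everything treated before if K_j is large, and f is the sum of these exponentials over all discs,
  with |f| >= j on the discs of layer j.
  A block of C successive layers with r_j = 2 d uses C point sets which together form a d-net of the
  sphere. A path that crosses the block without moving by more than d stays near one ray and hits a
  disc; so avoiding the discs costs length d. A block has thickness of order d^2, hence one can let
  d_b ~ 1/b, and the lengths add up to infinity.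
  Finally M is the zero set of f + <w,z> + c on a (k+1)-dimensional coordinate subspace, for generic
  (w, c).
*)
theory Submission
  imports Defs "HOL-Complex_Analysis.Complex_Analysis" "HOL-Real_Asymp.Real_Asymp"
begin

section \<open>Tangent discs as obstacles for paths\<close>

text \<open>The net consists of the points of a fine cubic lattice near the sphere, projected radially onto
  it; the color of a lattice point is the residue of its coordinates modulo \<open>34 d\<close>, where \<open>d\<close> is the
  dimension. Hence the number \<open>C\<close> of colors does not depend on \<open>\<delta>\<close>.\<close>

lemma colored_sphere_net:
  obtains C :: nat where "C > 0"
    "\<And>\<delta>. 0 < \<delta> \<Longrightarrow> \<delta> \<le> 1 \<Longrightarrow> \<exists>F :: nat \<Rightarrow> 'a::euclidean_space set.
      (\<forall>i<C. finite (F i) \<and> F i \<subseteq> sphere 0 1 \<and>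
        (\<forall>a\<in>F i. \<forall>b\<in>F i. a \<noteq> b \<longrightarrow> dist a b \<ge> 16 * \<delta>)) \<and>
      (\<forall>x\<in>sphere 0 1. \<exists>i<C. \<exists>a\<in>F i. dist x a \<le> \<delta>)"
proof -
  \<comment> \<open>Distinct lattice points of equal color differ in some coordinate by at least
    \<open>m\<close> steps of length \<open>h\<close>, that is by \<open>17 * \<delta>\<close>;
    projection to the sphere costs at most \<open>\<delta> / 2\<close> at each end and leaves
    \<open>16 * \<delta>\<close>.\<close>
  define m :: int where "m = 34 * int DIM('a)"
  have mpos: "m > 0" by (simp add: m_def)
  define Col where "Col = (Basis :: 'a set) \<rightarrow>\<^sub>E {0..<m}"
  have finCol: "finite Col" by (simp add: Col_def finite_PiE)
  have Colne: "Col \<noteq> {}" using mpos by (simp add: Col_def PiE_eq_empty_iff)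
  obtain e where e: "bij_betw e {0..<card Col} Col"
    using ex_bij_betw_nat_finite[OF finCol] by blast
  show ?thesis
  proof (rule that[of "card Col"])
    show "card Col > 0" using finCol Colne by (simp add: card_gt_0_iff)
  next
    fix \<delta> :: real assume \<delta>: "0 < \<delta>" "\<delta> \<le> 1"
    \<comment> \<open>Rounding all coordinates to the lattice then moves a point by at most
      \<open>\<delta> / 2\<close> in the l1 norm, hence in the Euclidean norm.\<close>
    define h where "h = \<delta> / (2 * DIM('a))"
    have hpos: "h > 0" using \<delta> by (simp add: h_def)
    have Dh: "DIM('a) * h = \<delta> / 2" by (simp add: h_def)
    have mh: "m * h = 17 * \<delta>" by (simp add: h_def m_def)
    define P :: "('a \<Rightarrow> int) \<Rightarrow> 'a" where "P k = (\<Sum>b\<in>Basis. (h * of_int (k b)) *\<^sub>R b)" for k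
    have P_inner: "P k \<bullet> b = h * of_int (k b)" if "b \<in> Basis" for k b
      using that by (simp add: P_def)
    define L where "L = \<lceil>1 / h\<rceil>"
    \<comment> \<open>Since \<open>\<delta> \<le> 1\<close>, the norm condition keeps the lattice
      points away from 0, so \<open>sgn\<close> projects them to the sphere and moves them by at
      most \<open>\<delta> / 2\<close>.\<close>
    define A where "A i = {k \<in> (Basis :: 'a set) \<rightarrow>\<^sub>E {-L..L}.
        (\<forall>b\<in>Basis. k b mod m = e i b) \<and> \<bar>norm (P k) - 1\<bar> \<le> \<delta> / 2}" for i
    define F where "F i = (\<lambda>k. sgn (P k)) ` A i" for i
    have near: "dist (sgn (P k)) (P k) \<le> \<delta> / 2 \<and> norm (sgn (P k)) = 1" if "k \<in> A i" for k i
    proof -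
      have n: "\<bar>norm (P k) - 1\<bar> \<le> \<delta> / 2" using that by (simp add: A_def)
      then have pos: "norm (P k) > 0" using \<delta> by linarith
      then have 1: "norm (sgn (P k)) = 1" by (simp add: norm_sgn)
      have "P k = norm (P k) *\<^sub>R sgn (P k)" using pos by (simp add: sgn_div_norm)
      then have "dist (sgn (P k)) (P k) = norm ((1 - norm (P k)) *\<^sub>R sgn (P k))"
        by (simp add: dist_norm algebra_simps)
      also have "\<dots> = \<bar>norm (P k) - 1\<bar>" using 1 by simp
      finally show ?thesis using n 1 by simp
    qed
    have fin: "finite (F i)" for i
    proof -
      have "A i \<subseteq> Basis \<rightarrow>\<^sub>E {-L..L}" by (auto simp: A_def)
      moreover have "finite ((Basis :: 'a set) \<rightarrow>\<^sub>E {-L..L})" by (simp add: finite_PiE)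
      ultimately show ?thesis unfolding F_def by (blast intro: finite_subset)
    qed
    have sph: "F i \<subseteq> sphere 0 1" for i
      using near by (auto simp: F_def)
    have sep: "dist a b \<ge> 16 * \<delta>" if ab: "a \<in> F i" "b \<in> F i" "a \<noteq> b" for i a b
    proof -
      obtain k where k: "k \<in> A i" "a = sgn (P k)" using ab(1) unfolding F_def by blast
      obtain l where l: "l \<in> A i" "b = sgn (P l)" using ab(2) unfolding F_def by blast
      have "k \<noteq> l" using ab k l by auto
      have kl: "k \<in> Basis \<rightarrow>\<^sub>E {-L..L}" "l \<in> Basis \<rightarrow>\<^sub>E {-L..L}"
        using k(1) l(1) unfolding A_def by blast+
      obtain c where c: "c \<in> Basis" "k c \<noteq> l c"
        using PiE_ext[OF kl] \<open>k \<noteq> l\<close> by blast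
      have "k c mod m = l c mod m" using k(1) l(1) c(1) by (simp add: A_def)
      then have "m dvd k c - l c" by (simp add: mod_eq_dvd_iff)
      then have "m \<le> \<bar>k c - l c\<bar>"
        using c mpos by (intro zdvd_imp_le) auto
      then have "real_of_int m * h \<le> \<bar>real_of_int (k c) - of_int (l c)\<bar> * h"
        using hpos by (intro mult_right_mono) linarith+
      also have "\<dots> = \<bar>(P k - P l) \<bullet> c\<bar>"
      proof -
        have "(P k - P l) \<bullet> c = (real_of_int (k c) - of_int (l c)) * h"
          using c(1) by (simp add: P_inner inner_diff_left algebra_simps)
        then show ?thesis using hpos by (simp add: abs_mult)
      qed
      also have "\<dots> \<le> dist (P k) (P l)"
        using Basis_le_norm[OF c(1)] by (simp add: dist_norm)
      also have "\<dots> \<le> dist (P k) a + dist a b + dist b (P l)"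
        using dist_triangle[of "P k" "P l" a] dist_triangle[of a "P l" b] by linarith
      also have "\<dots> \<le> \<delta> / 2 + dist a b + \<delta> / 2"
        using near[OF k(1)] near[OF l(1)] k l by (simp add: dist_commute)
      finally show ?thesis using mh by linarith
    qed
    have cov: "\<exists>i<card Col. \<exists>a\<in>F i. dist x a \<le> \<delta>" if x: "x \<in> sphere 0 1" for x
    proof -
      define k where "k = (\<lambda>b\<in>Basis. \<lfloor>x \<bullet> b / h\<rfloor>)"
      have nx: "norm x = 1" using x by simp
      have "k \<in> Basis \<rightarrow>\<^sub>E {-L..L}"
      proof (intro PiE_I)
        fix b :: 'a assume b: "b \<in> Basis"
        have "\<bar>x \<bullet> b\<bar> \<le> 1" using Basis_le_norm[OF b, of x] nx by simp
        then have "- (1 / h) \<le> x \<bullet> b / h" "x \<bullet> b / h \<le> 1 / h"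
          using hpos by (auto simp: field_simps abs_le_iff)
        then show "k b \<in> {-L..L}" using b unfolding k_def L_def
          by simp linarith
      qed (simp add: k_def)
      moreover have dP: "norm (x - P k) \<le> \<delta> / 2"
      proof -
        have "norm (x - P k) \<le> (\<Sum>b\<in>Basis. \<bar>(x - P k) \<bullet> b\<bar>)" by (rule norm_le_l1)
        also have "\<dots> \<le> (\<Sum>b\<in>(Basis::'a set). h)"
        proof (rule sum_mono)
          fix b :: 'a assume b: "b \<in> Basis"
          have "\<bar>x \<bullet> b / h - of_int \<lfloor>x \<bullet> b / h\<rfloor>\<bar> \<le> 1" by linarith
          then have "\<bar>x \<bullet> b / h - of_int \<lfloor>x \<bullet> b / h\<rfloor>\<bar> * h \<le> h" using hpos by (simp add: mult_left_le)
          moreover have "\<bar>x \<bullet> b / h - of_int \<lfloor>x \<bullet> b / h\<rfloor>\<bar> * h = \<bar>(x - P k) \<bullet> b\<bar>"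
            using hpos b by (simp add: inner_diff_left P_inner k_def field_simps abs_mult_pos')
          ultimately show "\<bar>(x - P k) \<bullet> b\<bar> \<le> h" by simp
        qed
        finally show ?thesis using Dh by simp
      qed
      then have "\<bar>norm (P k) - 1\<bar> \<le> \<delta> / 2"
        using nx norm_triangle_ineq3[of x "P k"] by linarith
      moreover obtain i where i: "i < card Col" "e i = (\<lambda>b\<in>Basis. k b mod m)"
      proof -
        have "(\<lambda>b\<in>Basis. k b mod m) \<in> Col" using mpos by (auto simp: Col_def)
        then have "(\<lambda>b\<in>Basis. k b mod m) \<in> e ` {0..<card Col}" using e by (simp add: bij_betw_def)
        then show ?thesis using that by auto
      qed
      ultimately have kA: "k \<in> A i" by (simp add: A_def)
      have "dist x (sgn (P k)) \<le> dist x (P k) + dist (P k) (sgn (P k))" by (rule dist_triangle)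
      also have "\<dots> \<le> \<delta>" using dP near[OF kA] by (simp add: dist_norm norm_minus_commute)
      finally show ?thesis using i kA by (auto simp: F_def)
    qed
    show "\<exists>F :: nat \<Rightarrow> 'a set.
      (\<forall>i<card Col. finite (F i) \<and> F i \<subseteq> sphere 0 1 \<and>
        (\<forall>a\<in>F i. \<forall>b\<in>F i. a \<noteq> b \<longrightarrow> dist a b \<ge> 16 * \<delta>)) \<and>
      (\<forall>x\<in>sphere 0 1. \<exists>i<card Col. \<exists>a\<in>F i. dist x a \<le> \<delta>)"
      by (intro exI[of _ F] conjI allI impI ballI fin sph sep cov)
  qed
qed

text \<open>The inner product is the real one also on \<open>complex ^ 'n\<close>, so the hyperplane
  has real codimension one and a path can be made to cross it.\<close>

definition tangent_disc :: "'a::real_inner \<Rightarrow> real \<Rightarrow> real \<Rightarrow> 'a set"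
  where "tangent_disc a s r = {z. z \<bullet> a = s \<and> norm (z - s *\<^sub>R a) \<le> r}"

lemma norm_sq_line:
  fixes a z :: "'a::real_inner"
  assumes "norm a = 1"
  shows "(norm (z - c *\<^sub>R a))\<^sup>2 = (norm z)\<^sup>2 - (z \<bullet> a)\<^sup>2 + (z \<bullet> a - c)\<^sup>2"
proof -
  have "a \<bullet> a = 1" using assms by (simp add: dot_square_norm)
  then show ?thesis
    unfolding power2_norm_eq_inner
    by (simp add: inner_diff_left inner_diff_right inner_commute power2_eq_square algebra_simps)
qed

text \<open>Intermediate value theorem for the height \<open>p t \<bullet> a\<close>. It is at most
  \<open>s\<close> initially by Cauchy-Schwarz, and at least \<open>s\<close> finally because the
  end point is far out but at most \<open>r\<close> away from the line through \<open>a\<close>. At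
  height \<open>s\<close>, closeness to that line is membership in the disc.\<close>

lemma narrow_path_meets_tangent_disc:
  fixes p :: "real \<Rightarrow> 'a::real_inner"
  assumes cont: "continuous_on {\<tau>..\<tau>'} p" and le: "\<tau> \<le> \<tau>'" and a: "norm a = 1"
    and start: "norm (p \<tau>) \<le> s" and s: "s > 0" and c: "c \<ge> 0" and r: "r \<ge> 0"
    and fin: "s\<^sup>2 + r\<^sup>2 \<le> (norm (p \<tau>'))\<^sup>2"
    and close: "\<And>t. t \<in> {\<tau>..\<tau>'} \<Longrightarrow> norm (p t - c *\<^sub>R a) \<le> r"
  shows "\<exists>t\<in>{\<tau>..\<tau>'}. p t \<in> tangent_disc a s r"
proof -
  have close2: "(norm (p t))\<^sup>2 - (p t \<bullet> a)\<^sup>2 + (p t \<bullet> a - c)\<^sup>2 \<le> r\<^sup>2" if "t \<in> {\<tau>..\<tau>'}" for t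
    using power_mono[OF close[OF that], of 2] by (simp add: norm_sq_line[OF a])
  have p1: "p \<tau> \<bullet> a \<le> s" using start norm_cauchy_schwarz[of "p \<tau>" a] a by simp
  have "s \<le> p \<tau>' \<bullet> a"
  proof -
    have 1: "(norm (p \<tau>'))\<^sup>2 - (p \<tau>' \<bullet> a)\<^sup>2 + (p \<tau>' \<bullet> a - c)\<^sup>2 \<le> r\<^sup>2"
      using close2 le by simp
    have "s\<^sup>2 \<le> (p \<tau>' \<bullet> a)\<^sup>2" using 1 fin zero_le_power2[of "p \<tau>' \<bullet> a - c"] by linarith
    then have abs: "s \<le> \<bar>p \<tau>' \<bullet> a\<bar>" using s by (metis abs_le_square_iff abs_of_pos)
    \<comment> \<open>Excludes height at most \<open>- s\<close>: a point of nonpositive height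
      within \<open>r\<close> of \<open>c *\<^sub>R a\<close> has norm at most \<open>r\<close>,
      against \<open>fin\<close>.\<close>
    have "p \<tau>' \<bullet> a > 0"
    proof (rule ccontr)
      assume "\<not> p \<tau>' \<bullet> a > 0"
      then have "c * (p \<tau>' \<bullet> a) \<le> 0" using c by (simp add: mult_nonneg_nonpos)
      moreover have "(p \<tau>' \<bullet> a - c)\<^sup>2 = (p \<tau>' \<bullet> a)\<^sup>2 - 2 * (c * (p \<tau>' \<bullet> a)) + c\<^sup>2"
        by (simp add: power2_eq_square algebra_simps)
      moreover have "s\<^sup>2 > 0" using s by simp
      ultimately show False using 1 fin zero_le_power2[of c] by linarith
    qed
    then show ?thesis using abs by simp
  qed
  moreover have "continuous_on {\<tau>..\<tau>'} (\<lambda>t. p t \<bullet> a)"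
    using cont by (intro continuous_intros)
  ultimately obtain t where t: "\<tau> \<le> t" "t \<le> \<tau>'" "p t \<bullet> a = s"
    using IVT'[of "\<lambda>t. p t \<bullet> a" \<tau> s \<tau>'] p1 le by blast
  have "(norm (p t))\<^sup>2 - s\<^sup>2 + (s - c)\<^sup>2 \<le> r\<^sup>2" using close2[of t] t by auto
  moreover have "(norm (p t - s *\<^sub>R a))\<^sup>2 = (norm (p t))\<^sup>2 - s\<^sup>2"
    using norm_sq_line[OF a, of "p t" s] t by simp
  ultimately have "(norm (p t - s *\<^sub>R a))\<^sup>2 \<le> r\<^sup>2"
    using zero_le_power2[of "s - c"] by linarith
  then have "norm (p t - s *\<^sub>R a) \<le> r" using r by (rule power2_le_imp_le)
  then show ?thesis using t by (auto simp: tangent_disc_def)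
qed

text \<open>A path that stays within \<open>\<delta>\<close> of its start also stays within
  \<open>2 * \<delta>\<close> of \<open>norm (p \<tau>) *\<^sub>R a\<close>, where \<open>a\<close>
  is a net vector near the direction of \<open>p \<tau>\<close>, so it meets the disc of
  \<open>a\<close>. Only the \<open>C\<close> layers together cover all directions; which layer
  stops the path depends on its start.\<close>

lemma block_crossing:
  fixes p :: "real \<Rightarrow> 'a::euclidean_space"
  assumes cont: "continuous_on {\<tau>..\<tau>'} p" and le: "\<tau> \<le> \<tau>'" and \<delta>: "\<delta> \<ge> 0"
    and net: "\<And>x. x \<in> sphere 0 1 \<Longrightarrow> \<exists>i<C. \<exists>a\<in>F i. dist x a \<le> \<delta>"
    and sph: "\<And>i. i < C \<Longrightarrow> F i \<subseteq> sphere 0 1"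
    and start: "\<And>i. i < C \<Longrightarrow> norm (p \<tau>) \<le> s i" "\<And>i. i < C \<Longrightarrow> s i > 0" "norm (p \<tau>) \<le> 1"
    and fin: "\<And>i. i < C \<Longrightarrow> (s i)\<^sup>2 + (2 * \<delta>)\<^sup>2 \<le> (norm (p \<tau>'))\<^sup>2"
    and avoid: "\<And>t i a. t \<in> {\<tau>..\<tau>'} \<Longrightarrow> i < C \<Longrightarrow> a \<in> F i \<Longrightarrow> p t \<notin> tangent_disc a (s i) (2 * \<delta>)"
  shows "\<exists>u\<in>{\<tau>..\<tau>'}. dist (p \<tau>) (p u) > \<delta>"
proof (rule ccontr)
  assume "\<not> ?thesis"
  then have near: "dist (p \<tau>) (p u) \<le> \<delta>" if "u \<in> {\<tau>..\<tau>'}" for u using that by force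
  obtain e where e: "norm e = 1" "p \<tau> = norm (p \<tau>) *\<^sub>R e"
  proof (cases "p \<tau> = 0")
    case True
    obtain b :: 'a where "b \<in> Basis" using nonempty_Basis by blast
    then show ?thesis using that[of b] True by simp
  next
    case False
    then show ?thesis using that[of "sgn (p \<tau>)"] by (simp add: norm_sgn sgn_div_norm)
  qed
  then obtain i a where i: "i < C" "a \<in> F i" "dist e a \<le> \<delta>" using net[of e] by auto
  have a: "norm a = 1" using sph i by force
  have "norm (p t - norm (p \<tau>) *\<^sub>R a) \<le> 2 * \<delta>" if "t \<in> {\<tau>..\<tau>'}" for t
  proof -
    have "norm (p \<tau> - norm (p \<tau>) *\<^sub>R a) = norm (norm (p \<tau>) *\<^sub>R (e - a))"
      using e(2) by (simp add: scaleR_diff_right)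
    also have "\<dots> = norm (p \<tau>) * norm (e - a)" by simp
    also have "\<dots> \<le> 1 * \<delta>"
      using i start by (intro mult_mono) (auto simp: dist_norm)
    finally have "norm (p \<tau> - norm (p \<tau>) *\<^sub>R a) \<le> \<delta>" by simp
    moreover have "norm (p t - p \<tau>) \<le> \<delta>" using near[OF that] by (simp add: dist_norm norm_minus_commute)
    moreover have "norm (p t - norm (p \<tau>) *\<^sub>R a) \<le> norm (p t - p \<tau>) + norm (p \<tau> - norm (p \<tau>) *\<^sub>R a)"
      by (metis diff_add_cancel add_diff_eq norm_triangle_ineq)
    ultimately show ?thesis by linarith
  qed
  then obtain t where "t \<in> {\<tau>..\<tau>'}" "p t \<in> tangent_disc a (s i) (2 * \<delta>)"
    using narrow_path_meets_tangent_disc[OF cont le a start(1)[OF i(1)] start(2)[OF i(1)] _ _ fin[OF i(1)], of "norm (p \<tau>)"] \<delta>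
    by auto
  then show False using avoid i by blast
qed

section \<open>Lower bounds for path lengths and first hitting times\<close>

lemma path_length_ge_sum_dist:
  assumes mono: "\<And>i. \<tau> i \<le> \<tau> (Suc i)" and mem: "\<And>i. \<tau> i \<in> I"
  shows "(\<Sum>i<n. ennreal (dist (p (\<tau> i)) (p (\<tau> (Suc i))))) \<le> path_length I p"
proof -
  define ts where "ts = map \<tau> [0..<Suc n]"
  have "mono \<tau>" using mono by (simp add: mono_iff_le_Suc)
  then have "sorted ts"
    unfolding ts_def by (simp add: sorted_iff_nth_mono mono_def nth_append del: upt_Suc)
  moreover have "set ts \<subseteq> I" using mem by (auto simp: ts_def)
  moreover have "(\<Sum>i<length ts - 1. ennreal (dist (p (ts ! i)) (p (ts ! Suc i)))) =
      (\<Sum>i<n. ennreal (dist (p (\<tau> i)) (p (\<tau> (Suc i)))))"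
    by (intro sum.cong) (auto simp: ts_def simp del: upt_Suc)
  ultimately show ?thesis
    unfolding path_length_def by (intro SUP_upper2[of ts]) auto
qed

text \<open>The partial sums of \<open>d\<close> are bounded by lengths of inscribed polygons, so a
  finite path length would force convergence.\<close>

lemma path_length_infinite:
  fixes p :: "real \<Rightarrow> 'a::metric_space"
  assumes mono: "\<And>i. \<tau> i \<le> \<tau> (Suc i)" and mem: "\<And>i. \<tau> i \<in> I"
    and d: "\<And>i. d i \<le> dist (p (\<tau> i)) (p (\<tau> (Suc i)))" "\<And>i. d i \<ge> 0" and ns: "\<not> summable d"
  shows "path_length I p = \<infinity>"
proof (rule ccontr)
  assume "path_length I p \<noteq> \<infinity>"
  then obtain B where B: "path_length I p = ennreal B" "B \<ge> 0"
    by (metis ennreal_cases infinity_ennreal_def)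
  have "(\<Sum>i<n. d i) \<le> B" for n
  proof -
    have "ennreal (\<Sum>i<n. d i) = (\<Sum>i<n. ennreal (d i))" using d by (simp add: sum_ennreal)
    also have "\<dots> \<le> (\<Sum>i<n. ennreal (dist (p (\<tau> i)) (p (\<tau> (Suc i)))))"
      by (intro sum_mono ennreal_leI d)
    also have "\<dots> \<le> ennreal B" using path_length_ge_sum_dist[of \<tau> I p n, OF mono mem] B by simp
    finally show ?thesis using B by (simp add: ennreal_le_iff)
  qed
  then have "summable d" using d(2) by (intro summableI_nonneg_bounded)
  then show False using ns by simp
qed

text \<open>Taking the first time keeps the path below the level until then, so every point found
  earlier is a legitimate start for the next block.\<close>

lemma first_hitting_time:
  fixes \<phi> :: "real \<Rightarrow> real"
  assumes cont: "continuous_on {a..b} \<phi>" and "a \<le> b" "\<phi> a \<le> R" "R \<le> \<phi> b"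
  obtains t where "t \<in> {a..b}" "\<phi> t = R" "\<And>u. u \<in> {a..t} \<Longrightarrow> \<phi> u \<le> R"
proof -
  define T where "T = {a..b} \<inter> \<phi> -` {R}"
  have "compact T"
    unfolding T_def
    by (metis compact_Icc compact_eq_bounded_closed bounded_Int cont closed_singleton continuous_closed_preimage)
  moreover have "T \<noteq> {}" using IVT'[of \<phi> a R b] assms by (auto simp: T_def)
  ultimately obtain t where t: "t \<in> T" "\<And>u. u \<in> T \<Longrightarrow> t \<le> u"
    by (metis compact_attains_inf)
  have "\<phi> u \<le> R" if u: "u \<in> {a..t}" for u
  proof (rule ccontr)
    assume "\<not> \<phi> u \<le> R"
    moreover have "continuous_on {a..u} \<phi>"
      by (rule continuous_on_subset[OF cont]) (use u t in \<open>auto simp: T_def\<close>)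
    ultimately obtain v where "a \<le> v" "v \<le> u" "\<phi> v = R"
      using IVT'[of \<phi> a R u] assms u by auto
    moreover from this have "v \<in> T" using u t(1) by (auto simp: T_def)
    ultimately have "v = t" "u = t" using t(2)[of v] u by auto
    then show False using \<open>\<not> \<phi> u \<le> R\<close> t by (auto simp: T_def)
  qed
  then show ?thesis using that t by (auto simp: T_def)
qed

section \<open>Series of exponentials\<close>

text \<open>Conjugation falls on the parameter \<open>a\<close>, so \<open>hdot a\<close> is complex
  linear in the variable and the exponentials built from it are holomorphic.\<close>

definition hdot :: "complex ^ 'n::finite \<Rightarrow> complex ^ 'n \<Rightarrow> complex"
  where "hdot a z = (\<Sum>i\<in>UNIV. z $ i * cnj (a $ i))"

lemma Re_hdot: "Re (hdot a z) = z \<bullet> a"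
  by (simp add: hdot_def inner_vec_def inner_complex_def)

definition wave :: "real \<Rightarrow> real \<Rightarrow> complex ^ 'n::finite \<Rightarrow> complex ^ 'n \<Rightarrow> complex"
  where "wave \<kappa> \<sigma> a z = exp (of_real \<kappa> * (hdot a z - of_real \<sigma>))"

lemma norm_wave: "norm (wave \<kappa> \<sigma> a z) = exp (\<kappa> * (z \<bullet> a - \<sigma>))"
  by (simp add: wave_def Re_hdot)

lemma norm_wave_le:
  assumes "norm a = 1" "norm z \<le> \<rho>" "\<kappa> \<ge> 0"
  shows "norm (wave \<kappa> \<sigma> a z) \<le> exp (\<kappa> * (\<rho> - \<sigma>))"
proof -
  have "z \<bullet> a \<le> \<rho>" using norm_cauchy_schwarz[of z a] assms by simp
  then show ?thesis using assms by (simp add: norm_wave mult_left_mono)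
qed

lemma has_derivative_hdot: "(hdot a has_derivative hdot a) (at z)"
  unfolding hdot_def
  by (intro has_derivative_sum has_derivative_mult_left bounded_linear_imp_has_derivative
      bounded_linear_vec_nth)

lemma has_derivative_wave:
  "(wave \<kappa> \<sigma> a has_derivative (\<lambda>h. of_real \<kappa> * hdot a h * wave \<kappa> \<sigma> a z)) (at z)"
proof -
  have "((\<lambda>w. of_real \<kappa> * (hdot a w - of_real \<sigma>)) has_derivative (\<lambda>h. of_real \<kappa> * hdot a h)) (at z)"
    by (auto intro!: derivative_eq_intros has_derivative_hdot)
  moreover have "(exp has_derivative (*) (exp (of_real \<kappa> * (hdot a z - of_real \<sigma>))))
      (at (of_real \<kappa> * (hdot a z - of_real \<sigma>)))"
    using DERIV_exp[of "of_real \<kappa> * (hdot a z - of_real \<sigma>)"]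
    by (simp add: has_field_derivative_def)
  ultimately have "((\<lambda>w. exp (of_real \<kappa> * (hdot a w - of_real \<sigma>))) has_derivative
      (\<lambda>h. exp (of_real \<kappa> * (hdot a z - of_real \<sigma>)) * (of_real \<kappa> * hdot a h))) (at z)"
    by (rule has_derivative_compose)
  then show ?thesis
    unfolding wave_def[abs_def] by (simp only: mult.commute)
qed

text \<open>The coefficients may vary with \<open>a\<close>, although \<open>large_on_discs\<close>
  takes them constant in each layer: this way the partial derivatives of a series are series of the
  same kind.\<close>

definition wave_layer :: "(nat \<Rightarrow> (complex ^ 'n::finite) set) \<Rightarrow> (nat \<Rightarrow> real) \<Rightarrow> (nat \<Rightarrow> real) \<Rightarrow>
    (nat \<Rightarrow> complex ^ 'n \<Rightarrow> complex) \<Rightarrow> nat \<Rightarrow> complex ^ 'n \<Rightarrow> complex"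
  where "wave_layer F \<kappa> s c j z = (\<Sum>a\<in>F j. c j a * wave (\<kappa> j) (s j) a z)"

definition wave_series :: "(nat \<Rightarrow> (complex ^ 'n::finite) set) \<Rightarrow> (nat \<Rightarrow> real) \<Rightarrow> (nat \<Rightarrow> real) \<Rightarrow>
    (nat \<Rightarrow> complex ^ 'n \<Rightarrow> complex) \<Rightarrow> complex ^ 'n \<Rightarrow> complex"
  where "wave_series F \<kappa> s c z = (\<Sum>j. wave_layer F \<kappa> s c j z)"

lemma norm_wave_layer_le:
  assumes "\<And>a. a \<in> F j \<Longrightarrow> norm a = 1" "norm z \<le> \<rho>" "\<kappa> j \<ge> 0"
    and "\<And>a. a \<in> F j \<Longrightarrow> norm (c j a) \<le> B"
  shows "norm (wave_layer F \<kappa> s c j z) \<le> card (F j) * (B * exp (\<kappa> j * (\<rho> - s j)))"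
  unfolding wave_layer_def
proof (rule order_trans[OF sum_norm_le[of _ _ "\<lambda>_. B * exp (\<kappa> j * (\<rho> - s j))"]])
  fix a assume a: "a \<in> F j"
  have "B \<ge> 0" using assms(4)[OF a] norm_ge_zero order_trans by blast
  then show "norm (c j a * wave (\<kappa> j) (s j) a z) \<le> B * exp (\<kappa> j * (\<rho> - s j))"
    unfolding norm_mult using assms a by (intro mult_mono norm_wave_le) auto
qed simp

locale wave_data =
  fixes F :: "nat \<Rightarrow> (complex ^ 'n::finite) set" and \<kappa> s \<rho> :: "nat \<Rightarrow> real"
  assumes norm_F: "a \<in> F j \<Longrightarrow> norm a = 1" and \<kappa>_nonneg: "\<kappa> j \<ge> 0"
    and \<rho>_mono: "mono \<rho>" and \<rho>_lim: "\<rho> \<longlonglongrightarrow> 1"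
begin

text \<open>Layer \<open>j\<close> is then at most \<open>(1/2) ^ j\<close> on the ball of radius
  \<open>\<rho> j\<close>. As \<open>\<rho>\<close> tends to 1, this yields locally uniform
  convergence in the open unit ball.\<close>

definition tame :: "(nat \<Rightarrow> complex ^ 'n \<Rightarrow> complex) \<Rightarrow> (nat \<Rightarrow> real) \<Rightarrow> bool"
  where "tame c B \<longleftrightarrow> (\<forall>j. \<forall>a\<in>F j. norm (c j a) \<le> B j) \<and> (\<forall>j. B j \<ge> 0) \<and>
    (\<forall>j. card (F j) * (B j * exp (\<kappa> j * (\<rho> j - s j))) \<le> (1/2) ^ j)"

text \<open>Weierstrass majorant for the ball of radius \<open>\<rho> m\<close>: tameness controls
  the layers from \<open>m\<close> on, and the finitely many earlier ones are estimated with
  \<open>norm z \<le> 1\<close> only.\<close>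

definition majorant :: "(nat \<Rightarrow> real) \<Rightarrow> nat \<Rightarrow> nat \<Rightarrow> real"
  where "majorant B m j = (if j < m then card (F j) * (B j * exp (\<kappa> j * (1 - s j))) else (1/2) ^ j)"

lemma summable_majorant: "summable (majorant B m)"
proof -
  have "eventually (\<lambda>j. majorant B m j = (1/2) ^ j) sequentially"
    using eventually_ge_at_top[of m] by eventually_elim (simp add: majorant_def)
  then have "summable (majorant B m) \<longleftrightarrow> summable (\<lambda>j. (1/2 :: real) ^ j)"
    by (rule summable_cong)
  then show ?thesis by simp
qed

lemma wave_layer_le_majorant:
  assumes "tame c B" "norm z \<le> \<rho> m"
  shows "norm (wave_layer F \<kappa> s c j z) \<le> majorant B m j"
proof (cases "j < m")
  case True
  have "\<rho> m \<le> 1" using \<rho>_mono \<rho>_lim by (metis incseq_le)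
  then show ?thesis
    using norm_wave_layer_le[of F j z 1 \<kappa> c "B j" s] norm_F \<kappa>_nonneg assms True
    by (simp add: tame_def majorant_def)
next
  case False
  have "norm z \<le> \<rho> j" using assms(2) \<rho>_mono False by (meson monoD not_less order_trans)
  then have "norm (wave_layer F \<kappa> s c j z) \<le> card (F j) * (B j * exp (\<kappa> j * (\<rho> j - s j)))"
    using norm_wave_layer_le[of F j z "\<rho> j" \<kappa> c "B j" s] norm_F \<kappa>_nonneg assms by (simp add: tame_def)
  also have "\<dots> \<le> (1/2) ^ j" using assms by (simp add: tame_def)
  finally show ?thesis using False by (simp add: majorant_def)
qed

lemma summable_wave_layer:
  assumes "tame c B" "norm z \<le> \<rho> m"
  shows "summable (\<lambda>j. wave_layer F \<kappa> s c j z)"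
  by (rule summable_comparison_test'[OF summable_majorant wave_layer_le_majorant[OF assms]])

definition dcoeff :: "(nat \<Rightarrow> complex ^ 'n \<Rightarrow> complex) \<Rightarrow> 'n \<Rightarrow> nat \<Rightarrow> complex ^ 'n \<Rightarrow> complex"
  where "dcoeff c i j a = of_real (\<kappa> j) * cnj (a $ i) * c j a"

text \<open>Coordinates of a unit vector have modulus at most 1, so a derivative enlarges the
  coefficient bound only by the factor \<open>\<kappa> j\<close>, which a steep exponential can
  absorb.\<close>

lemma tame_dcoeff:
  assumes "\<And>j a. a \<in> F j \<Longrightarrow> norm (c j a) \<le> B j" "\<And>j. B j \<ge> 0"
    "\<And>j. card (F j) * (\<kappa> j * B j * exp (\<kappa> j * (\<rho> j - s j))) \<le> (1/2) ^ j"
  shows "tame (dcoeff c i) (\<lambda>j. \<kappa> j * B j)"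
proof -
  have "norm (dcoeff c i j a) \<le> \<kappa> j * B j" if a: "a \<in> F j" for j a
  proof -
    have "norm (dcoeff c i j a) = \<kappa> j * (norm (a $ i) * norm (c j a))"
      using \<kappa>_nonneg[of j] by (simp add: dcoeff_def norm_mult)
    also have "\<dots> \<le> \<kappa> j * (1 * B j)"
      using \<kappa>_nonneg assms(1)[OF a] Finite_Cartesian_Product.norm_nth_le[of a i] norm_F[OF a]
      by (intro mult_left_mono mult_mono) auto
    finally show ?thesis by simp
  qed
  then show ?thesis using assms \<kappa>_nonneg by (simp add: tame_def mult.assoc)
qed

lemma has_derivative_wave_layer:
  "(wave_layer F \<kappa> s c j has_derivative
     (\<lambda>h. \<Sum>i\<in>UNIV. wave_layer F \<kappa> s (dcoeff c i) j z * h $ i)) (at z within S)"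
proof -
  have "(wave_layer F \<kappa> s c j has_derivative
      (\<lambda>h. \<Sum>a\<in>F j. c j a * (of_real (\<kappa> j) * hdot a h * wave (\<kappa> j) (s j) a z))) (at z)"
    unfolding wave_layer_def[abs_def]
    by (intro has_derivative_sum has_derivative_mult_right has_derivative_wave)
  moreover have "(\<lambda>h. \<Sum>a\<in>F j. c j a * (of_real (\<kappa> j) * hdot a h * wave (\<kappa> j) (s j) a z)) =
      (\<lambda>h. \<Sum>i\<in>UNIV. wave_layer F \<kappa> s (dcoeff c i) j z * h $ i)"
    unfolding wave_layer_def hdot_def dcoeff_def sum_distrib_left sum_distrib_right
    by (subst sum.swap) (simp add: mult_ac)
  ultimately show ?thesis by (simp add: has_derivative_at_withinI)
qed

text \<open>Termwise differentiation on a ball of radius \<open>\<rho> m\<close> that contains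
  \<open>z\<close>: there the majorant for \<open>B'\<close> makes the differentiated series
  converge uniformly.\<close>

lemma has_derivative_wave_series:
  assumes c: "tame c B" and c': "\<And>i. tame (dcoeff c i) B'" and z: "z \<in> ball 0 1"
  shows "(wave_series F \<kappa> s c has_derivative
     (\<lambda>h. \<Sum>i\<in>UNIV. wave_series F \<kappa> s (dcoeff c i) z * h $ i)) (at z)"
proof -
  define f' where "f' j x h = (\<Sum>i\<in>UNIV. wave_layer F \<kappa> s (dcoeff c i) j x * h $ i)" for j and x h :: "complex ^ 'n"
  define g' where "g' x h = (\<Sum>i\<in>UNIV. wave_series F \<kappa> s (dcoeff c i) x * h $ i)" for x h :: "complex ^ 'n"
  have "eventually (\<lambda>j. norm z < \<rho> j) sequentially"
    using z by (intro order_tendstoD(1)[OF \<rho>_lim]) simp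
  then obtain m where m: "norm z < \<rho> m" by (auto simp: eventually_sequentially)
  define X where "X j = CARD('n) * majorant B' m j" for j
  have sumX: "summable X" unfolding X_def by (intro summable_mult summable_majorant)
  have f'_le: "norm (f' j x h) \<le> X j * norm h" if x: "x \<in> ball 0 (\<rho> m)" for j and x h :: "complex ^ 'n"
  proof -
    have "norm (f' j x h) \<le> (\<Sum>i\<in>(UNIV::'n set). majorant B' m j * norm h)"
      unfolding f'_def
    proof (rule sum_norm_le)
      fix i
      have "norm (wave_layer F \<kappa> s (dcoeff c i) j x) \<le> majorant B' m j"
        using x by (intro wave_layer_le_majorant[OF c']) simp
      then show "norm (wave_layer F \<kappa> s (dcoeff c i) j x * h $ i) \<le> majorant B' m j * norm h"
        unfolding norm_mult using Finite_Cartesian_Product.norm_nth_le[of h i]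
        by (intro mult_mono) (auto intro: order_trans[OF norm_ge_zero])
    qed
    then show ?thesis by (simp add: X_def)
  qed
  have f'_sums: "(\<lambda>j. f' j x h) sums g' x h" if x: "x \<in> ball 0 (\<rho> m)" for x h :: "complex ^ 'n"
    unfolding f'_def g'_def wave_series_def using x
    by (intro sums_sum sums_mult2 summable_sums summable_wave_layer[OF c', of _ m]) simp
  have unif: "\<forall>\<^sub>F n in sequentially. \<forall>x\<in>ball 0 (\<rho> m). \<forall>h :: complex ^ 'n. norm (sum (\<lambda>i. f' i x h) {..<n} - g' x h) \<le> e * norm h"
    if e: "e > 0" for e
  proof -
    obtain N where N: "\<And>n. n \<ge> N \<Longrightarrow> norm (\<Sum>i. X (i + n)) < e"
      using suminf_exist_split[OF e sumX] by blast
    show ?thesis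
      unfolding eventually_sequentially
    proof (intro exI[of _ N] allI impI ballI)
      fix n and x h :: "complex ^ 'n" assume n: "N \<le> n" and x: "x \<in> ball 0 (\<rho> m)"
      have sm: "summable (\<lambda>j. f' j x h)" using f'_sums[OF x] by (rule sums_summable)
      have sX: "summable (\<lambda>i. X (i + n) * norm h)"
        using sumX by (intro summable_mult2) (simp add: summable_iff_shift)
      have "g' x h - sum (\<lambda>i. f' i x h) {..<n} = (\<Sum>i. f' (i + n) x h)"
        using suminf_minus_initial_segment[OF sm, of n] f'_sums[OF x] by (simp add: sums_iff)
      then have "norm (sum (\<lambda>i. f' i x h) {..<n} - g' x h) = norm (\<Sum>i. f' (i + n) x h)"
        by (metis norm_minus_commute)
      also have "\<dots> \<le> (\<Sum>i. X (i + n) * norm h)"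
        by (rule norm_suminf_le[OF f'_le[OF x] sX])
      also have "\<dots> = (\<Sum>i. X (i + n)) * norm h"
        using sumX by (intro suminf_mult2[symmetric]) (simp add: summable_iff_shift)
      also have "\<dots> \<le> e * norm h"
        using N[OF n] by (intro mult_right_mono) auto
      finally show "norm (sum (\<lambda>i. f' i x h) {..<n} - g' x h) \<le> e * norm h" .
    qed
  qed
  have "\<exists>g. \<forall>x\<in>ball 0 (\<rho> m). (\<lambda>j. wave_layer F \<kappa> s c j x) sums (g x) \<and>
      (g has_derivative g' x) (at x within ball 0 (\<rho> m))"
  proof (rule has_derivative_series[where f' = f'])
    show "(wave_layer F \<kappa> s c n has_derivative f' n x) (at x within ball 0 (\<rho> m))" for n x
      unfolding f'_def by (rule has_derivative_wave_layer)
    show "z \<in> ball 0 (\<rho> m)" using m by simp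
    show "(\<lambda>n. wave_layer F \<kappa> s c n z) sums wave_series F \<kappa> s c z"
      unfolding wave_series_def using m by (intro summable_sums summable_wave_layer[OF c, of _ m]) simp
  qed (use unif in auto)
  then obtain g where g: "\<And>x. x \<in> ball 0 (\<rho> m) \<Longrightarrow> (\<lambda>j. wave_layer F \<kappa> s c j x) sums (g x)"
      "\<And>x. x \<in> ball 0 (\<rho> m) \<Longrightarrow> (g has_derivative g' x) (at x within ball 0 (\<rho> m))"
    by blast
  have zb: "z \<in> ball 0 (\<rho> m)" using m by simp
  have "(g has_derivative g' z) (at z)"
    using g(2)[OF zb] zb by (simp add: at_within_open[OF _ open_ball])
  moreover have "g x = wave_series F \<kappa> s c x" if "x \<in> ball 0 (\<rho> m)" for x
    using g(1)[OF that] by (simp add: wave_series_def sums_iff)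
  ultimately have "(wave_series F \<kappa> s c has_derivative g' z) (at z)"
    using has_derivative_transform_within_open[of g "g' z" z UNIV "ball 0 (\<rho> m)"] zb by simp
  then show ?thesis by (simp add: g'_def[abs_def])
qed

end

section \<open>A function that is large on all discs\<close>

text \<open>Layer \<open>j\<close> lives between the radii \<open>\<rho> j\<close> and
  \<open>\<rho> (Suc j)\<close>: its discs touch the sphere of radius \<open>s j\<close> from
  outside, and by Pythagoras \<open>step\<close> keeps their points within radius
  \<open>\<rho> (Suc j)\<close>.\<close>

locale disc_layers =
  fixes F :: "nat \<Rightarrow> (complex ^ 'n::finite) set" and s \<rho> r :: "nat \<Rightarrow> real"
  assumes finite_F: "finite (F j)" and norm_F: "a \<in> F j \<Longrightarrow> norm a = 1"
    and sep: "a \<in> F j \<Longrightarrow> b \<in> F j \<Longrightarrow> a \<noteq> b \<Longrightarrow> dist a b \<ge> 8 * r j"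
    and r_pos: "r j > 0" and \<rho>_nonneg: "\<rho> j \<ge> 0" and \<rho>_less: "\<rho> j < s j"
    and s_ge_half: "s j \<ge> 1/2" and step: "(s j)\<^sup>2 + (r j)\<^sup>2 \<le> (\<rho> (Suc j))\<^sup>2"
    and \<rho>_lim: "\<rho> \<longlonglongrightarrow> 1"
begin

lemma s_le_\<rho>_Suc: "s j \<le> \<rho> (Suc j)"
proof -
  have "(s j)\<^sup>2 \<le> (\<rho> (Suc j))\<^sup>2" using step[of j] zero_le_power2[of "r j"] by linarith
  then show ?thesis using \<rho>_nonneg by (rule power2_le_imp_le)
qed

lemma mono_\<rho>: "mono \<rho>"
  using \<rho>_less s_le_\<rho>_Suc by (intro mono_iff_le_Suc[THEN iffD2] allI) (meson less_imp_le order_trans)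

lemma \<rho>_le_1: "\<rho> j \<le> 1"
  using mono_\<rho> \<rho>_lim by (metis incseq_le)

lemma norm_tangent_disc:
  assumes "a \<in> F j" "z \<in> tangent_disc a (s j) (r j)"
  shows "norm z \<le> \<rho> (Suc j)"
proof (rule power2_le_imp_le)
  have "(norm (z - s j *\<^sub>R a))\<^sup>2 = (norm z)\<^sup>2 - (s j)\<^sup>2"
    using norm_sq_line[OF norm_F[OF assms(1)], of z "s j"] assms by (simp add: tangent_disc_def)
  moreover have "(norm (z - s j *\<^sub>R a))\<^sup>2 \<le> (r j)\<^sup>2"
    using assms by (intro power_mono) (auto simp: tangent_disc_def)
  ultimately show "(norm z)\<^sup>2 \<le> (\<rho> (Suc j))\<^sup>2" using step[of j] by linarith
qed (rule \<rho>_nonneg)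

definition gap :: "nat \<Rightarrow> real"
  where "gap j = min (8 * (r j)\<^sup>2) (s j - \<rho> j)"

lemma gap_pos: "gap j > 0"
  using r_pos[of j] \<rho>_less[of j] by (simp add: gap_def)

text \<open>With \<open>d\<close> the distance of the directions, turning from \<open>b\<close> to
  \<open>a\<close> lowers the height of the centre by \<open>s j * d\<^sup>2 / 2\<close>, while the
  extent of the disc restores at most \<open>r j * d\<close>. Separation lets the quadratic term
  win.\<close>

lemma tangent_disc_below_other:
  assumes a: "a \<in> F j" and b: "b \<in> F j" and "a \<noteq> b" and z: "z \<in> tangent_disc b (s j) (r j)"
  shows "z \<bullet> a - s j \<le> - gap j"
proof -
  define d where "d = norm (a - b)"
  have d: "d \<ge> 8 * r j" using sep[OF a b \<open>a \<noteq> b\<close>] by (simp add: d_def dist_norm)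
  have na: "a \<bullet> a = 1" "b \<bullet> b = 1" using norm_F[OF a] norm_F[OF b] by (simp_all add: dot_square_norm)
  have "d\<^sup>2 = 2 - 2 * (b \<bullet> a)"
    unfolding d_def power2_norm_eq_inner by (simp add: inner_diff_left inner_diff_right na inner_commute)
  then have 1: "b \<bullet> (a - b) = - d\<^sup>2 / 2" by (simp add: inner_diff_right na)
  have "z \<bullet> a = z \<bullet> b + s j * (b \<bullet> (a - b)) + (z - s j *\<^sub>R b) \<bullet> (a - b)"
    by (simp add: inner_diff_left inner_diff_right algebra_simps)
  also have "z \<bullet> b = s j" using z by (simp add: tangent_disc_def)
  finally have "z \<bullet> a - s j = - (s j * d\<^sup>2 / 2) + (z - s j *\<^sub>R b) \<bullet> (a - b)" using 1 by simp
  also have "(z - s j *\<^sub>R b) \<bullet> (a - b) \<le> norm (z - s j *\<^sub>R b) * d"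
    unfolding d_def by (rule norm_cauchy_schwarz)
  also have "\<dots> \<le> r j * d"
    using z by (intro mult_right_mono) (auto simp: tangent_disc_def d_def)
  also have "- (s j * d\<^sup>2 / 2) \<le> - (1/2 * d\<^sup>2 / 2)"
    using s_ge_half[of j] mult_right_mono[of "1/2" "s j" "d\<^sup>2"] by simp
  finally have "z \<bullet> a - s j \<le> - (d * (d / 4 - r j))" by (simp add: power2_eq_square algebra_simps)
  moreover have "(8 * r j) * (r j) \<le> d * (d / 4 - r j)"
    using d r_pos[of j] by (intro mult_mono) auto
  ultimately show ?thesis by (simp add: gap_def power2_eq_square)
qed

text \<open>Exponential decay beats any polynomial. The factor \<open>(1 + \<kappa>)\<^sup>2\<close>
  dominates 1, \<open>\<kappa>\<close> and \<open>\<kappa>\<^sup>2\<close>, so one exponent serves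
  the series and its first and second derivatives.\<close>

lemma steep_exponent_exists:
  "\<exists>\<kappa>\<ge>0. card (F j) * (C * ((1 + \<kappa>)\<^sup>2 * exp (- (\<kappa> * gap j)))) \<le> (1/2) ^ j"
proof -
  have "((\<lambda>\<kappa>. M * (C * ((1 + \<kappa>)\<^sup>2 * exp (- (\<kappa> * g))))) \<longlongrightarrow> 0) at_top" if "g > 0" for M g :: real
    using that by real_asymp
  then have "eventually (\<lambda>\<kappa>. card (F j) * (C * ((1 + \<kappa>)\<^sup>2 * exp (- (\<kappa> * gap j)))) < (1/2) ^ j) at_top"
    by (rule order_tendstoD) (auto simp: gap_pos)
  then have "eventually (\<lambda>\<kappa>. \<kappa> \<ge> 0 \<and> card (F j) * (C * ((1 + \<kappa>)\<^sup>2 * exp (- (\<kappa> * gap j)))) < (1/2) ^ j) at_top"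
    using eventually_ge_at_top[of 0] by eventually_elim simp
  then show ?thesis
    by (metis (mono_tags, lifting) eventually_happens less_imp_le trivial_limit_at_top_linorder)
qed

text \<open>On a disc of layer \<open>j\<close> its own wave has modulus \<open>C j\<close>; the
  earlier layers amount to at most \<open>A j\<close>, the rest of the layer and all later layers to
  at most 1 each, so \<open>j + 1\<close> remains. Differentiability of \<open>D\<close> is recorded
  for the choice of generic parameters.\<close>

lemma large_on_discs:
  obtains f :: "complex ^ 'n \<Rightarrow> complex" and D :: "'n \<Rightarrow> complex ^ 'n \<Rightarrow> complex" where
    "\<And>z. z \<in> ball 0 1 \<Longrightarrow> (f has_derivative (\<lambda>h. \<Sum>i\<in>UNIV. D i z * h $ i)) (at z)"
    "\<And>i z. z \<in> ball 0 1 \<Longrightarrow> D i differentiable (at z)"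
    "\<And>j a z. a \<in> F j \<Longrightarrow> z \<in> tangent_disc a (s j) (r j) \<Longrightarrow> norm (f z) \<ge> real j"
proof -
  obtain kap where kap: "\<And>j C. kap j C \<ge> 0"
      "\<And>j C. card (F j) * (C * ((1 + kap j C)\<^sup>2 * exp (- (kap j C * gap j)))) \<le> (1/2) ^ j"
    using steep_exponent_exists by metis
  \<comment> \<open>The exponent of a layer depends on \<open>C j\<close>, and \<open>C j\<close> on
    all earlier exponents; the recursion therefore carries only the accumulated bound. The factor
    \<open>exp (kap j (j + 3 + x))\<close> bounds a wave on the unit ball because
    \<open>s j \<ge> 0\<close>.\<close>
  define A where "A = rec_nat 0 (\<lambda>j x. x + card (F j) * ((j + 3 + x) * exp (kap j (j + 3 + x))))"
  define C where "C j = j + 3 + A j" for j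
    \<comment> \<open>\<open>A j\<close> bounds the layers before \<open>j\<close> on the whole unit ball, so \<open>C j\<close> dominates them.\<close>
  define \<kappa> where "\<kappa> j = kap j (C j)" for j
  have A_0: "A 0 = 0" and A_Suc: "A (Suc j) = A j + card (F j) * (C j * exp (\<kappa> j))" for j
    by (simp_all add: A_def C_def \<kappa>_def)
  have A_nonneg: "A j \<ge> 0" for j by (induction j) (simp_all add: A_0 A_Suc C_def)
  have A_sum: "A j = (\<Sum>l<j. card (F l) * (C l * exp (\<kappa> l)))" for j
    by (induction j) (simp_all add: A_0 A_Suc)
  have C_nonneg: "C j \<ge> 0" for j using A_nonneg[of j] by (simp add: C_def)
  have \<kappa>_nonneg: "\<kappa> j \<ge> 0" for j by (simp add: \<kappa>_def kap)
  have steep: "card (F j) * (C j * (x * exp (\<kappa> j * y))) \<le> (1/2) ^ j"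
    if "0 \<le> x" "x \<le> (1 + \<kappa> j)\<^sup>2" "y \<le> - gap j" for j x y
  proof -
    have "\<kappa> j * y \<le> - (\<kappa> j * gap j)" using mult_left_mono[OF that(3) \<kappa>_nonneg] by simp
    then have "card (F j) * (C j * (x * exp (\<kappa> j * y))) \<le>
        card (F j) * (C j * ((1 + \<kappa> j)\<^sup>2 * exp (- (\<kappa> j * gap j))))"
      using that C_nonneg by (intro mult_left_mono mult_mono) auto
    also have "\<dots> \<le> (1/2) ^ j" using kap by (simp add: \<kappa>_def)
    finally show ?thesis .
  qed
  have s_nonneg: "s j \<ge> 0" for j using s_ge_half[of j] by linarith
  interpret wave_data F \<kappa> s \<rho>
    by unfold_locales (use norm_F \<kappa>_nonneg mono_\<rho> \<rho>_lim in auto)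
  define c :: "nat \<Rightarrow> complex ^ 'n \<Rightarrow> complex" where "c j a = of_real (C j)" for j a
  have norm_c: "norm (c j a) \<le> C j" for j a using C_nonneg[of j] by (simp add: c_def)
  have gap: "\<rho> j - s j \<le> - gap j" for j by (simp add: gap_def)
  \<comment> \<open>The three cases serve the series, its gradient and the derivatives of the
    gradient.\<close>
  have sq: "1 \<le> (1 + \<kappa> j)\<^sup>2" "\<kappa> j \<le> (1 + \<kappa> j)\<^sup>2" "\<kappa> j * \<kappa> j \<le> (1 + \<kappa> j)\<^sup>2" for j
    using \<kappa>_nonneg[of j] by (auto simp: power2_eq_square algebra_simps)
  have tame0: "tame c C"
    using norm_c C_nonneg steep[OF _ sq(1) gap] by (simp add: tame_def)
  have tame1: "tame (dcoeff c i) (\<lambda>j. \<kappa> j * C j)" for i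
    using norm_c C_nonneg steep[OF _ sq(2) gap] \<kappa>_nonneg by (intro tame_dcoeff) (auto simp: mult_ac)
  have tame2: "tame (dcoeff (dcoeff c i) i') (\<lambda>j. \<kappa> j * (\<kappa> j * C j))" for i i'
    using tame1[of i] C_nonneg steep[OF _ sq(3) gap] \<kappa>_nonneg
    by (intro tame_dcoeff) (auto simp: tame_def mult_ac)
  show ?thesis
  proof (rule that[of "wave_series F \<kappa> s c" "\<lambda>i. wave_series F \<kappa> s (dcoeff c i)"])
    show "(wave_series F \<kappa> s c has_derivative
        (\<lambda>h. \<Sum>i\<in>UNIV. wave_series F \<kappa> s (dcoeff c i) z * h $ i)) (at z)" if "z \<in> ball 0 1" for z
      using has_derivative_wave_series[OF tame0 tame1 that] .
    show "wave_series F \<kappa> s (dcoeff c i) differentiable (at z)" if "z \<in> ball 0 1" for i z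
      using has_derivative_wave_series[OF tame1 tame2 that] unfolding differentiable_def by blast
  next
    fix j a z assume a: "a \<in> F j" and z: "z \<in> tangent_disc a (s j) (r j)"
    define w where "w l = wave_layer F \<kappa> s c l z" for l
    have nz: "norm z \<le> \<rho> (Suc j)" using norm_tangent_disc[OF a z] .
    have sm: "summable w" unfolding w_def using summable_wave_layer[OF tame0 nz] .
    have "norm (\<Sum>l<j. w l) \<le> A j"
      unfolding A_sum
    proof (rule sum_norm_le)
      fix l
      have "norm (w l) \<le> card (F l) * (C l * exp (\<kappa> l * (1 - s l)))"
        unfolding w_def using norm_F \<kappa>_nonneg norm_c nz \<rho>_le_1[of "Suc j"]
        by (intro norm_wave_layer_le) auto
      also have "\<dots> \<le> card (F l) * (C l * exp (\<kappa> l))"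
        using s_nonneg[of l] \<kappa>_nonneg[of l] C_nonneg[of l]
        by (intro mult_left_mono) (auto simp: mult_left_le)
      finally show "norm (w l) \<le> card (F l) * (C l * exp (\<kappa> l))" .
    qed
    \<comment> \<open>The point has norm at most \<open>\<rho> (Suc j)\<close>, where all layers
      after \<open>j\<close> are dominated by the geometric series.\<close>
    moreover have "norm (\<Sum>l. w (l + Suc j)) \<le> 1"
    proof -
      have "norm (w (l + Suc j)) \<le> (1/2) ^ Suc l" for l
      proof -
        have "norm (w (l + Suc j)) \<le> majorant C (Suc j) (l + Suc j)"
          unfolding w_def using wave_layer_le_majorant[OF tame0 nz] .
        also have "\<dots> = (1/2) ^ (l + Suc j)" by (simp add: majorant_def)
        also have "\<dots> \<le> (1/2) ^ Suc l" by (intro power_decreasing) auto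
        finally show ?thesis .
      qed
      then have "norm (\<Sum>l. w (l + Suc j)) \<le> (\<Sum>l. (1/2) ^ Suc l)"
        by (rule norm_suminf_le) (use power_half_series in \<open>simp add: sums_iff\<close>)
      then show ?thesis using power_half_series by (simp add: sums_iff)
    qed
    moreover have "norm (w j) \<ge> C j - 1"
    proof -
      define v where "v b = c j b * wave (\<kappa> j) (s j) b z" for b
      have split: "w j = v a + (\<Sum>b\<in>F j - {a}. v b)"
        unfolding w_def wave_layer_def v_def using sum.remove[OF finite_F a] by blast
      have va: "norm (v a) = C j"
        using z C_nonneg[of j] by (simp add: v_def norm_mult norm_wave tangent_disc_def c_def)
      have "norm (\<Sum>b\<in>F j - {a}. v b) \<le> card (F j - {a}) * (C j * exp (\<kappa> j * - gap j))"
      proof (rule sum_norm_bound)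
        fix b assume b: "b \<in> F j - {a}"
        have "z \<bullet> b - s j \<le> - gap j"
          using tangent_disc_below_other[OF _ a _ z, of b] b by auto
        then have "norm (wave (\<kappa> j) (s j) b z) \<le> exp (\<kappa> j * - gap j)"
          unfolding norm_wave exp_le_cancel_iff using \<kappa>_nonneg by (intro mult_left_mono)
        then show "norm (v b) \<le> C j * exp (\<kappa> j * - gap j)"
          unfolding v_def norm_mult using norm_c C_nonneg by (intro mult_mono) auto
      qed
      also have "\<dots> \<le> card (F j) * (C j * exp (\<kappa> j * - gap j))"
        using C_nonneg finite_F by (intro mult_right_mono) (auto intro: card_mono)
      also have "\<dots> \<le> (1/2) ^ j" using steep[OF _ sq(1), of "- gap j" j] by simp
      also have "\<dots> \<le> 1" by (simp add: power_le_one)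
      finally have "norm (\<Sum>b\<in>F j - {a}. v b) \<le> 1" .
      then show ?thesis
        using split va norm_diff_ineq[of "v a" "\<Sum>b\<in>F j - {a}. v b"] by simp
    qed
    moreover have "wave_series F \<kappa> s c z = w j + (\<Sum>l<j. w l) + (\<Sum>l. w (l + Suc j))"
    proof -
      have "wave_series F \<kappa> s c z = suminf w" by (simp add: wave_series_def w_def[abs_def])
      then show ?thesis using suminf_split_initial_segment[OF sm, of "Suc j"] by simp
    qed
    moreover have "norm (w j + p + q) \<ge> norm (w j) - norm p - norm q" for p q
      using norm_diff_ineq[of "w j + p" q] norm_diff_ineq[of "w j" p] by linarith
    ultimately have "norm (wave_series F \<kappa> s c z) \<ge> C j - 1 - A j - 1" by (smt (verit))
    then show "norm (wave_series F \<kappa> s c z) \<ge> real j" by (simp add: C_def)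
  qed
qed

end

section \<open>Choice of the radii, and infinite length block by block\<close>

theorem holomorphic_unbounded_on_finite_length_paths:
  obtains f :: "complex ^ 'n::finite \<Rightarrow> complex" and D :: "'n \<Rightarrow> complex ^ 'n \<Rightarrow> complex" where
    "\<And>z. z \<in> ball 0 1 \<Longrightarrow> (f has_derivative (\<lambda>h. \<Sum>i\<in>UNIV. D i z * h $ i)) (at z)"
    "\<And>i z. z \<in> ball 0 1 \<Longrightarrow> D i differentiable (at z)"
    "\<And>p B. continuous_on {0..<1} p \<Longrightarrow> ((\<lambda>t. norm (p t)) \<longlongrightarrow> 1) (at_left (1::real)) \<Longrightarrow>
        p ` {0..<1} \<subseteq> ball 0 1 \<Longrightarrow>
        (\<forall>t\<in>{0..<1}. norm (f (p t)) \<le> B) \<Longrightarrow> path_length {0..<1} p = \<infinity>"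
proof -
  obtain C :: nat where C: "C > 0" and
    net: "\<And>\<delta>. 0 < \<delta> \<Longrightarrow> \<delta> \<le> 1 \<Longrightarrow> \<exists>F :: nat \<Rightarrow> (complex ^ 'n) set.
      (\<forall>i<C. finite (F i) \<and> F i \<subseteq> sphere 0 1 \<and>
        (\<forall>a\<in>F i. \<forall>b\<in>F i. a \<noteq> b \<longrightarrow> dist a b \<ge> 16 * \<delta>)) \<and>
      (\<forall>x\<in>sphere 0 1. \<exists>i<C. \<exists>a\<in>F i. dist x a \<le> \<delta>)"
    using colored_sphere_net[where 'a = "complex ^ 'n"] by metis
  \<comment> \<open>The last layer of block \<open>b\<close> has index
    \<open>j = (b + 1) * C - 1\<close>, for which \<open>2 * j + 3\<close> is exactly the
    denominator of \<open>2 * \<delta> b\<close>; hence \<open>r j \<le> 1 / (2 * j + 3)\<close>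
    throughout the block, while \<open>\<delta>\<close> still decays only harmonically.\<close>
  define \<delta> :: "nat \<Rightarrow> real" where "\<delta> b = 1 / (2 * (2 * (real b + 1) * C + 1))" for b
  have two_\<delta>: "2 * \<delta> b = 1 / (2 * (real b + 1) * C + 1)" for b
  proof -
    have "2 * (1 / (2 * y)) = 1 / y" for y :: real by simp
    then show ?thesis unfolding \<delta>_def .
  qed
  have \<delta>: "0 < \<delta> b" "\<delta> b \<le> 1" for b
  proof -
    have "2 * (2 * (real b + 1) * C + 1) \<ge> 1" by simp
    moreover have "0 < 1 / x \<and> 1 / x \<le> 1" if "x \<ge> 1" for x :: real using that by simp
    ultimately show "0 < \<delta> b" "\<delta> b \<le> 1" unfolding \<delta>_def by blast+
  qed
  obtain G :: "nat \<Rightarrow> nat \<Rightarrow> (complex ^ 'n) set" where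
    G: "\<And>b i. i < C \<Longrightarrow> finite (G b i) \<and> G b i \<subseteq> sphere 0 1 \<and>
        (\<forall>a\<in>G b i. \<forall>a'\<in>G b i. a \<noteq> a' \<longrightarrow> dist a a' \<ge> 16 * \<delta> b)"
    and cover: "\<And>b x. x \<in> sphere 0 1 \<Longrightarrow> \<exists>i<C. \<exists>a\<in>G b i. dist x a \<le> \<delta> b"
    using net[OF \<delta>] by metis
  \<comment> \<open>Block \<open>b\<close> consists of the layers \<open>b * C + i\<close> with
    \<open>i < C\<close>, one per color of the net at scale \<open>\<delta> b\<close>.\<close>
  define F where "F j = G (j div C) (j mod C)" for j
  define r where "r j = 2 * \<delta> (j div C)" for j
  \<comment> \<open>The squares interleave: \<open>(\<rho> (Suc j))\<^sup>2 - (s j)\<^sup>2 = 1 /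
    ((2 * j + 2) * (2 * j + 3))\<close>, which leaves room for \<open>(r j)\<^sup>2\<close>.\<close>
  define \<rho> where "\<rho> j = sqrt (1 - 1 / (2 * real j + 1))" for j
  define s where "s j = sqrt (1 - 1 / (2 * real j + 2))" for j
  have \<rho>2: "(\<rho> j)\<^sup>2 = 1 - 1 / (2 * real j + 1)" and s2: "(s j)\<^sup>2 = 1 - 1 / (2 * real j + 2)" for j
    by (simp_all add: \<rho>_def s_def field_simps)
  have r_le: "r j \<le> 1 / (2 * real j + 3)" for j
  proof -
    have "j < (j div C + 1) * C"
      using C by (metis Suc_eq_plus1 dividend_less_times_div mult.commute mult_Suc_right add.commute)
    then have "real j + 1 \<le> (real (j div C) + 1) * C"
      by (metis Suc_eq_plus1 Suc_leI of_nat_1 of_nat_add of_nat_le_iff of_nat_mult)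
    then have "2 * real j + 3 \<le> 2 * (real (j div C) + 1) * C + 1" by linarith
    then have "1 / (2 * (real (j div C) + 1) * C + 1) \<le> 1 / (2 * real j + 3)"
      by (intro divide_left_mono) (auto intro!: mult_pos_pos add_pos_nonneg)
    then show ?thesis unfolding r_def two_\<delta> .
  qed
  interpret disc_layers F s \<rho> r
  proof
    show "finite (F j)" "a \<in> F j \<Longrightarrow> norm a = 1" for j a
      using G[of "j mod C" "j div C"] C by (auto simp: F_def)
    show "dist a b \<ge> 8 * r j" if "a \<in> F j" "b \<in> F j" "a \<noteq> b" for a b j
      using G[of "j mod C" "j div C"] C that by (auto simp: F_def r_def)
    show "r j > 0" for j using \<delta> by (simp add: r_def)
    show "\<rho> j \<ge> 0" for j by (simp add: \<rho>_def)
    show "\<rho> j < s j" for j by (simp add: \<rho>_def s_def field_simps)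
    show "s j \<ge> 1/2" for j
      unfolding s_def by (rule real_le_rsqrt) (simp add: power2_eq_square field_simps)
    show "(s j)\<^sup>2 + (r j)\<^sup>2 \<le> (\<rho> (Suc j))\<^sup>2" for j
    proof -
      have "(r j)\<^sup>2 \<le> (1 / (2 * real j + 3))\<^sup>2"
        using r_le \<delta> by (intro power_mono) (auto simp: r_def less_imp_le)
      also have "\<dots> \<le> 1 / (2 * real j + 2) - 1 / (2 * real j + 3)"
      proof -
        have "1 / (2 * real j + 2) - 1 / (2 * real j + 3) = 1 / ((2 * real j + 2) * (2 * real j + 3))"
          by (simp add: divide_simps)
        moreover have "(1 / (2 * real j + 3))\<^sup>2 = 1 / ((2 * real j + 3) * (2 * real j + 3))"
          by (simp add: power2_eq_square)
        moreover have "1 / ((2 * real j + 3) * (2 * real j + 3)) \<le> 1 / ((2 * real j + 2) * (2 * real j + 3))"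
          by (intro divide_left_mono mult_right_mono mult_pos_pos) auto
        ultimately show ?thesis by simp
      qed
      finally show ?thesis by (simp add: \<rho>2 s2 algebra_simps)
    qed
    show "\<rho> \<longlonglongrightarrow> 1" unfolding \<rho>_def by real_asymp
  qed
  obtain f :: "complex ^ 'n \<Rightarrow> complex" and D where
    f: "\<And>z. z \<in> ball 0 1 \<Longrightarrow> (f has_derivative (\<lambda>h. \<Sum>i\<in>UNIV. D i z * h $ i)) (at z)"
      "\<And>i z. z \<in> ball 0 1 \<Longrightarrow> D i differentiable (at z)"
    and large: "\<And>j a z. a \<in> F j \<Longrightarrow> z \<in> tangent_disc a (s j) (r j) \<Longrightarrow> norm (f z) \<ge> real j"
    by (rule large_on_discs) (rule that)
  have "path_length {0..<1} p = \<infinity>"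
    if cont: "continuous_on {0..<1} p" and lim: "((\<lambda>t. norm (p t)) \<longlongrightarrow> 1) (at_left (1::real))"
      and bounded: "\<forall>t\<in>{0..<1}. norm (f (p t)) \<le> B" and inball: "p ` {0..<1} \<subseteq> ball 0 1" for p B
  proof -
    obtain J :: nat where J: "B < real J" using reals_Archimedean2 by blast
    have "norm (p 0) < 1" using inball by (auto simp: image_subset_iff)
    then have "eventually (\<lambda>j. norm (p 0) < \<rho> j) sequentially"
      by (rule order_tendstoD(1)[OF \<rho>_lim])
    then obtain J' where J': "\<And>j. j \<ge> J' \<Longrightarrow> norm (p 0) < \<rho> j" by (auto simp: eventually_sequentially)
    \<comment> \<open>From block \<open>b\<^sub>0\<close> on, the lower bound of \<open>f\<close> on
      the discs exceeds \<open>B\<close>, and \<open>p 0\<close> lies below the block.\<close>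
    define b\<^sub>0 where "b\<^sub>0 = max J J'"
    have b\<^sub>0: "b * C \<ge> J" "b * C \<ge> J'" if "b \<ge> b\<^sub>0" for b
    proof -
      have "b \<le> b * C" using C by simp
      moreover have "J \<le> b" "J' \<le> b" using that by (auto simp: b\<^sub>0_def)
      ultimately show "b * C \<ge> J" "b * C \<ge> J'" by linarith+
    qed
    \<comment> \<open>The point \<open>u\<close> need not have crossed block \<open>b\<close>; still
      within radius \<open>\<rho> (Suc b * C)\<close>, it can start block
      \<open>Suc b\<close>.\<close>
    have advance: "\<exists>u. (u \<in> {0..<1} \<and> norm (p u) \<le> \<rho> (Suc b * C)) \<and> (t \<le> u \<and> \<delta> b \<le> dist (p t) (p u))"
      if b: "b \<ge> b\<^sub>0" and t: "t \<in> {0..<1}" "norm (p t) \<le> \<rho> (b * C)" for b t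
    proof -
      define R where "R = \<rho> (Suc b * C)"
      have "\<rho> j < 1" for j by (simp add: \<rho>_def)
      then have "R < 1" by (simp add: R_def)
      then have "eventually (\<lambda>t. R < norm (p t)) (at_left 1)" by (rule order_tendstoD(1)[OF lim])
      moreover have "eventually (\<lambda>x. x \<in> {t<..<1}) (at_left 1)"
        by (rule eventually_at_leftI[of t]) (use t in auto)
      ultimately have "eventually (\<lambda>x. R < norm (p x) \<and> x \<in> {t<..<1}) (at_left 1)"
        by (rule eventually_conj)
      then obtain t\<^sub>2 where t\<^sub>2: "R < norm (p t\<^sub>2)" "t < t\<^sub>2" "t\<^sub>2 < 1"
        by (metis (mono_tags, lifting) eventually_happens greaterThanLessThan_iff trivial_limit_at_left_real)
      have c: "continuous_on {t..t\<^sub>2} p"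
        by (rule continuous_on_subset[OF cont]) (use t t\<^sub>2 in auto)
      have "norm (p t) \<le> R" by (rule order_trans[OF t(2)]) (simp add: R_def monoD[OF mono_\<rho>])
      then obtain t' where t': "t' \<in> {t..t\<^sub>2}" "norm (p t') = R" "\<And>u. u \<in> {t..t'} \<Longrightarrow> norm (p u) \<le> R"
        using first_hitting_time[of t t\<^sub>2 "\<lambda>x. norm (p x)" R] c t\<^sub>2 by (auto intro: continuous_on_norm)
      have F_eq: "F (b * C + i) = G b i" "r (b * C + i) = 2 * \<delta> b" if "i < C" for i
        using that by (simp_all add: F_def r_def)
      have "\<exists>u\<in>{t..t'}. dist (p t) (p u) > \<delta> b"
      proof (rule block_crossing[where F = "G b" and s = "\<lambda>i. s (b * C + i)"])
        show "continuous_on {t..t'} p" by (rule continuous_on_subset[OF c]) (use t' in auto)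
        show "t \<le> t'" "\<delta> b \<ge> 0" using t' \<delta>[of b] by auto
        show "x \<in> sphere 0 1 \<Longrightarrow> \<exists>i<C. \<exists>a\<in>G b i. dist x a \<le> \<delta> b" for x by (rule cover)
        show "i < C \<Longrightarrow> G b i \<subseteq> sphere 0 1" for i using G by blast
        show "norm (p t) \<le> s (b * C + i)" for i
          using t(2) monoD[OF mono_\<rho>, of "b * C" "b * C + i"] \<rho>_less[of "b * C + i"] by simp
        show "s (b * C + i) > 0" for i using s_ge_half[of "b * C + i"] by linarith
        show "norm (p t) \<le> 1" using inball t by (auto simp: image_subset_iff less_imp_le)
        show "(s (b * C + i))\<^sup>2 + (2 * \<delta> b)\<^sup>2 \<le> (norm (p t'))\<^sup>2" if i: "i < C" for i
        proof -
          have "(s (b * C + i))\<^sup>2 + (2 * \<delta> b)\<^sup>2 \<le> (\<rho> (Suc (b * C + i)))\<^sup>2"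
            using step[of "b * C + i"] F_eq[OF i] by simp
          also have "\<dots> \<le> R\<^sup>2"
            unfolding R_def using i by (intro power_mono monoD[OF mono_\<rho>] \<rho>_nonneg) simp
          finally show ?thesis using t' by simp
        qed
        show "p x \<notin> tangent_disc a (s (b * C + i)) (2 * \<delta> b)"
          if x: "x \<in> {t..t'}" and i: "i < C" and a: "a \<in> G b i" for x i a
        proof
          assume "p x \<in> tangent_disc a (s (b * C + i)) (2 * \<delta> b)"
          then have "real (b * C + i) \<le> norm (f (p x))" using large[of a "b * C + i"] F_eq[OF i] a by simp
          moreover have "norm (f (p x)) \<le> B" using bounded x t t' t\<^sub>2 by auto
          moreover have "real J \<le> real (b * C + i)" using b\<^sub>0[OF b] by linarith
          ultimately show False using J by linarith
        qed
      qed
      then obtain u where "u \<in> {t..t'}" "dist (p t) (p u) > \<delta> b" by blast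
      then show ?thesis
        using t t' t\<^sub>2 by (intro exI[of _ u]) (auto simp: R_def)
    qed
    \<comment> \<open>Iterates \<open>advance\<close> from time 0; the radius bound is the
      invariant, the displacement the relation between successive times.\<close>
    have "\<exists>\<tau>. \<forall>n. (\<tau> n \<in> {0..<1} \<and> norm (p (\<tau> n)) \<le> \<rho> ((b\<^sub>0 + n) * C)) \<and>
        (\<tau> n \<le> \<tau> (Suc n) \<and> \<delta> (b\<^sub>0 + n) \<le> dist (p (\<tau> n)) (p (\<tau> (Suc n))))"
    proof (rule dependent_nat_choice)
      show "\<exists>t. t \<in> {0..<1} \<and> norm (p t) \<le> \<rho> ((b\<^sub>0 + 0) * C)"
        using J' b\<^sub>0[of b\<^sub>0] by (intro exI[of _ 0]) (auto simp: less_imp_le)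
    next
      fix t n assume "t \<in> {0..<1} \<and> norm (p t) \<le> \<rho> ((b\<^sub>0 + n) * C)"
      then show "\<exists>u. (u \<in> {0..<1} \<and> norm (p u) \<le> \<rho> ((b\<^sub>0 + Suc n) * C)) \<and>
          (t \<le> u \<and> \<delta> (b\<^sub>0 + n) \<le> dist (p t) (p u))"
        using advance[of "b\<^sub>0 + n" t] by simp
    qed
    then obtain \<tau> where \<tau>: "\<And>n. \<tau> n \<in> {0..<1}" "\<And>n. \<tau> n \<le> \<tau> (Suc n)"
        "\<And>n. \<delta> (b\<^sub>0 + n) \<le> dist (p (\<tau> n)) (p (\<tau> (Suc n)))"
      by blast
    have "\<not> summable (\<lambda>n. \<delta> (b\<^sub>0 + n))"
    proof
      assume "summable (\<lambda>n. \<delta> (b\<^sub>0 + n))"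
      then have "summable \<delta>" using summable_iff_shift[of \<delta> b\<^sub>0] by (simp add: add.commute)
      \<comment> \<open>The constant comes from
        \<open>2 * (b + 1) * C + 1 \<le> (2 * C + 1) * (b + 1)\<close>, which compares
        \<open>\<delta>\<close> with the harmonic series.\<close>
      then have "summable (\<lambda>b. 2 * (2 * C + 1) * \<delta> b)" by (rule summable_mult)
      then have "summable (\<lambda>b. inverse (real (Suc b)))"
      proof (rule summable_comparison_test')
        fix b :: nat
        have "2 * (real b + 1) * C + 1 \<le> (2 * C + 1) * (real b + 1)" by (simp add: algebra_simps)
        then have "2 * (2 * C + 1) * (1 / (2 * ((2 * C + 1) * (real b + 1)))) \<le> 2 * (2 * C + 1) * \<delta> b"
          unfolding \<delta>_def by (intro mult_left_mono divide_left_mono) (use C in \<open>auto intro!: mult_pos_pos add_nonneg_pos\<close>)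
        moreover have "2 * (2 * C + 1) * (1 / (2 * ((2 * C + 1) * (real b + 1)))) = inverse (real (Suc b))"
          by (simp add: divide_simps) (simp add: algebra_simps)
        ultimately show "norm (inverse (real (Suc b))) \<le> 2 * (2 * C + 1) * \<delta> b" by simp
      qed
      then show False
        using not_summable_harmonic[where 'a = real] by (simp add: summable_iff_shift[of "\<lambda>n. inverse (real n)" 1, simplified])
    qed
    then show ?thesis
      by (intro path_length_infinite[of \<tau> "{0..<1}" "\<lambda>n. \<delta> (b\<^sub>0 + n)" p] \<tau>) (use \<delta> in \<open>auto simp: less_imp_le\<close>)
  qed
  then show ?thesis using that[of f D] f by blast
qed

section \<open>Regular zero sets as submanifolds\<close>

lemma has_derivative_vec_lambda:
  fixes f :: "'i::finite \<Rightarrow> 'a::real_normed_vector \<Rightarrow> complex"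
  assumes "\<And>i. (f i has_derivative f' i) (at x within S)"
  shows "((\<lambda>x. \<chi> i. f i x) has_derivative (\<lambda>h. \<chi> i. f' i h)) (at x within S)"
proof (subst has_derivative_componentwise_within, intro ballI)
  fix b :: "complex ^ 'i" assume "b \<in> Basis"
  then obtain i u where b: "b = axis i u" by (auto simp: Basis_vec_def)
  show "((\<lambda>x. (\<chi> i. f i x) \<bullet> b) has_derivative (\<lambda>h. (\<chi> i. f' i h) \<bullet> b)) (at x within S)"
    using assms[of i] by (auto simp: b inner_axis intro!: derivative_eq_intros)
qed

lemma norm_axis:
  fixes x :: complex
  shows "norm (axis i x :: complex ^ 'n::finite) = norm x"
  by (simp add: norm_eq_sqrt_inner inner_axis_axis)

lemma linear_complex_iff:
  fixes L :: "complex ^ 'n::finite \<Rightarrow> complex ^ 'm::finite"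
  shows "Vector_Spaces.linear (*s) (*s) L \<longleftrightarrow>
    (\<forall>x y. L (x + y) = L x + L y) \<and> (\<forall>c x. L (c *s x) = c *s L x)"
  by (simp add: Vector_Spaces.linear_iff vec.vector_space_axioms)

lemma linear_complex_inv:
  fixes L :: "complex ^ 'n::finite \<Rightarrow> complex ^ 'n"
  assumes "Vector_Spaces.linear (*s) (*s) L" "bij L"
  shows "Vector_Spaces.linear (*s) (*s) (inv L)"
  unfolding linear_complex_iff
proof (intro conjI allI)
  have L: "L (inv L x) = x" for x using assms(2) by (simp add: bij_is_surj surj_f_inv_f)
  have inj: "L x = L y \<Longrightarrow> x = y" for x y using assms(2) by (simp add: bij_is_inj inj_eq)
  show "inv L (x + y) = inv L x + inv L y" for x y
    by (rule inj) (use assms(1) in \<open>simp add: linear_complex_iff L\<close>)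
  show "inv L (c *s x) = c *s inv L x" for c x
    by (rule inj) (use assms(1) in \<open>simp add: linear_complex_iff L\<close>)
qed

text \<open>Real inverse function theorem for the map that puts \<open>g\<close> into coordinate
  \<open>i\<^sub>0\<close>. A vector in the kernel of its derivative has all other coordinates zero,
  and \<open>nz\<close> kills the remaining one. The inverse is holomorphic since its derivative
  inverts a complex linear map.\<close>

lemma replace_coordinate_biholomorphism:
  fixes g :: "complex ^ 'n::finite \<Rightarrow> complex" and e :: "'n \<Rightarrow> complex ^ 'n \<Rightarrow> complex"
  assumes W: "open W" "z\<^sub>0 \<in> W"
    and der: "\<And>z. z \<in> W \<Longrightarrow> (g has_derivative (\<lambda>h. \<Sum>i\<in>UNIV. e i z * h $ i)) (at z)"
    and cont: "\<And>i. continuous_on W (e i)" and nz: "e i\<^sub>0 z\<^sub>0 \<noteq> 0"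
  obtains U V \<Psi> where "z\<^sub>0 \<in> U" "U \<subseteq> W" "biholomorphism U V (\<lambda>z. \<chi> j. if j = i\<^sub>0 then g z else z $ j) \<Psi>"
proof -
  define \<Phi> where "\<Phi> z = (\<chi> j. if j = i\<^sub>0 then g z else z $ j)" for z
  define lin where "lin z h = (\<chi> j. if j = i\<^sub>0 then \<Sum>i\<in>UNIV. e i z * h $ i else h $ j)" for z and h :: "complex ^ 'n"
  have der\<Phi>: "(\<Phi> has_derivative lin z) (at z)" if "z \<in> W" for z
    unfolding \<Phi>_def[abs_def] lin_def[abs_def]
  proof (rule has_derivative_vec_lambda)
    fix j
    show "((\<lambda>x. if j = i\<^sub>0 then g x else x $ j) has_derivative
        (\<lambda>h. if j = i\<^sub>0 then \<Sum>i\<in>UNIV. e i z * h $ i else h $ j)) (at z)"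
      using der[OF that] bounded_linear_imp_has_derivative[OF bounded_linear_vec_nth]
      by (cases "j = i\<^sub>0") simp_all
  qed
  have lin_linear: "Vector_Spaces.linear (*s) (*s) (lin z)" for z
    by (auto simp: linear_complex_iff lin_def vec_eq_iff sum.distrib sum_distrib_left algebra_simps)
  have bl: "bounded_linear (lin z)" if "z \<in> W" for z using der\<Phi>[OF that] by (rule has_derivative_bounded_linear)
  define B where "B z = Blinfun (lin z)" for z
  have B: "blinfun_apply (B z) = lin z" if "z \<in> W" for z
    unfolding B_def using bl[OF that] by (rule bounded_linear_Blinfun_apply)
  \<comment> \<open>The derivative has to be continuous in operator norm; in finite dimension it
    suffices to test it on basis vectors.\<close>
  have contB: "continuous_on W B"
  proof (rule continuous_on_blinfun_componentwise)
    fix b :: "complex ^ 'n" assume "b \<in> Basis"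
    have "continuous_on W (\<lambda>z. lin z b)"
      unfolding lin_def
    proof (rule continuous_on_vec_lambda)
      have "continuous_on W (\<lambda>z. \<Sum>i\<in>UNIV. e i z * b $ i)" using cont by (intro continuous_intros)
      then show "continuous_on W (\<lambda>z. if j = i\<^sub>0 then \<Sum>i\<in>UNIV. e i z * b $ i else b $ j)" for j
        by (cases "j = i\<^sub>0") simp_all
    qed
    then show "continuous_on W (\<lambda>z. blinfun_apply (B z) b)"
      by (rule continuous_on_eq) (simp add: B)
  qed
  have lin_0: "h = 0" if h: "lin z\<^sub>0 h = 0" for h
  proof -
    have comp: "(if j = i\<^sub>0 then \<Sum>i\<in>UNIV. e i z\<^sub>0 * h $ i else h $ j) = 0" for j
      using arg_cong[OF h, of "\<lambda>x. x $ j"] by (simp add: lin_def)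
    have other: "h $ j = 0" if "j \<noteq> i\<^sub>0" for j using comp[of j] that by simp
    have "(\<Sum>i\<in>UNIV. e i z\<^sub>0 * h $ i) = e i\<^sub>0 z\<^sub>0 * h $ i\<^sub>0"
      using other by (subst sum.remove[of _ i\<^sub>0]) (auto intro!: sum.neutral)
    then have "h $ i\<^sub>0 = 0" using comp[of i\<^sub>0] nz by simp
    then show "h = 0" using other by (metis vec_eq_iff zero_index)
  qed
  have linear_lin: "linear (lin z\<^sub>0)" using bl[OF W(2)] by (rule bounded_linear.linear)
  then have "inj (lin z\<^sub>0)" using lin_0 linear_injective_0 by blast
  then obtain k where k: "linear k" "k \<circ> lin z\<^sub>0 = id"
    using linear_injective_left_inverse[OF linear_lin] by blast
  have inv: "Blinfun k o\<^sub>L B z\<^sub>0 = id_blinfun"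
    using k by (intro blinfun_eqI)
      (simp add: B[OF W(2)] bounded_linear_Blinfun_apply linear_conv_bounded_linear pointfree_idE)
  obtain U V \<Psi> \<Psi>' where UV: "open U" "U \<subseteq> W" "z\<^sub>0 \<in> U" "open V" "\<Phi> z\<^sub>0 \<in> V" "homeomorphism U V \<Phi> \<Psi>"
    and \<Psi>: "\<And>y. y \<in> V \<Longrightarrow> (\<Psi> has_derivative (\<Psi>' y)) (at y)"
      "\<And>y. y \<in> V \<Longrightarrow> \<Psi>' y = Hilbert_Choice.inv (blinfun_apply (B (\<Psi> y)))"
      "\<And>y. y \<in> V \<Longrightarrow> bij (blinfun_apply (B (\<Psi> y)))"
    by (rule inverse_function_theorem[OF W(1) _ contB W(2) inv, of \<Phi>]) (auto simp: B der\<Phi>)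
  have "holomorphic_map_on \<Phi> U"
    unfolding holomorphic_map_on_def using der\<Phi> lin_linear UV(2) by blast
  moreover have "holomorphic_map_on \<Psi> V"
    unfolding holomorphic_map_on_def
  proof
    fix y assume y: "y \<in> V"
    then have "\<Psi> y \<in> W" using UV by (auto simp: homeomorphism_def)
    then have "\<Psi>' y = Hilbert_Choice.inv (lin (\<Psi> y))" "bij (lin (\<Psi> y))"
      using \<Psi>(2,3)[OF y] B by auto
    then show "\<exists>D. (\<Psi> has_derivative D) (at y) \<and> Vector_Spaces.linear (*s) (*s) D"
      using \<Psi>(1)[OF y] linear_complex_inv[OF lin_linear] by auto
  qed
  ultimately have "biholomorphism U V \<Phi> \<Psi>"
    using UV by (simp add: biholomorphism_def)
  then show ?thesis using that UV(2,3) unfolding \<Phi>_def[abs_def] by blast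
qed

text \<open>Near a point of \<open>M\<close>, a coordinate \<open>i\<close> in \<open>S\<close> with
  nonzero partial derivative is replaced by \<open>g\<close>. In the new coordinates
  \<open>M\<close> is the vanishing of all coordinates outside \<open>S - {i}\<close>, and
  \<open>k\<close> of them stay free.\<close>

lemma regular_zero_set_closed_submanifold:
  fixes g :: "complex ^ 'n::finite \<Rightarrow> complex" and e :: "'n \<Rightarrow> complex ^ 'n \<Rightarrow> complex" and S :: "'n set"
  defines "M \<equiv> {z \<in> ball 0 1. (\<forall>j. j \<notin> S \<longrightarrow> z $ j = 0) \<and> g z = 0}"
  assumes der: "\<And>z. z \<in> ball 0 1 \<Longrightarrow> (g has_derivative (\<lambda>h. \<Sum>i\<in>UNIV. e i z * h $ i)) (at z)"
    and cont: "\<And>i. continuous_on (ball 0 1) (e i)"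
    and regular: "\<And>z. z \<in> M \<Longrightarrow> \<exists>i\<in>S. e i z \<noteq> 0"
    and ne: "M \<noteq> {}" and card: "card S = Suc k"
  shows "closed_submanifold_of_ball k M"
proof -
  have "complex_submanifold k M"
    unfolding complex_submanifold_def
  proof (intro conjI ballI ne)
    fix z assume z: "z \<in> M"
    then obtain i where i: "i \<in> S" "e i z \<noteq> 0" using regular by blast
    define \<Phi> where "\<Phi> x = (\<chi> j. if j = i then g x else x $ j)" for x
    have z_ball: "z \<in> ball 0 1" using z by (simp add: M_def)
    obtain U V \<Psi> where U: "z \<in> U" "U \<subseteq> ball 0 1"
      and "biholomorphism U V (\<lambda>x. \<chi> j. if j = i then g x else x $ j) \<Psi>"
      by (rule replace_coordinate_biholomorphism[where e = e, OF open_ball z_ball der cont i(2)])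
        (assumption, rule that)
    then have bi: "biholomorphism U V \<Phi> \<Psi>" unfolding \<Phi>_def[abs_def] by blast
    define L where "L = {x :: complex ^ 'n. \<forall>j. j \<notin> S - {i} \<longrightarrow> x $ j = 0}"
    have "vec.subspace L" by (auto simp: vec.subspace_def L_def)
    moreover have "vec.dim L = k"
      unfolding L_def dim_substandard_cart using card i by (simp add: card_Diff_singleton)
    moreover have "\<Phi> ` (M \<inter> U) = L \<inter> V"
    proof (intro equalityI subsetI)
      fix y assume "y \<in> \<Phi> ` (M \<inter> U)"
      then obtain x where x: "x \<in> M" "x \<in> U" "y = \<Phi> x" by auto
      then have "y \<in> V" using bi by (auto simp: biholomorphism_def homeomorphism_def)
      then show "y \<in> L \<inter> V" using x by (auto simp: L_def M_def \<Phi>_def)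
    next
      fix y assume y: "y \<in> L \<inter> V"
      then have \<Psi>: "\<Psi> y \<in> U" "\<Phi> (\<Psi> y) = y" using bi by (auto simp: biholomorphism_def homeomorphism_def)
      have comp: "(if j = i then g (\<Psi> y) else \<Psi> y $ j) = y $ j" for j
        using arg_cong[OF \<Psi>(2), of "\<lambda>x. x $ j"] by (simp add: \<Phi>_def)
      have "\<Psi> y $ j = 0" if "j \<notin> S" for j
      proof -
        have "j \<noteq> i" using that i by blast
        then show ?thesis using comp[of j] that y by (simp add: L_def)
      qed
      moreover have "g (\<Psi> y) = 0" using comp[of i] y by (auto simp: L_def)
      ultimately have "\<Psi> y \<in> M" using \<Psi>(1) U(2) by (auto simp: M_def)
      then show "y \<in> \<Phi> ` (M \<inter> U)" using \<Psi> by force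
    qed
    ultimately show "\<exists>U V \<Phi> \<Psi> L. z \<in> U \<and> biholomorphism U V \<Phi> \<Psi> \<and>
        vec.subspace L \<and> vec.dim L = k \<and> \<Phi> ` (M \<inter> U) = L \<inter> V"
      using U(1) bi by blast
  qed
  moreover have "closedin (top_of_set (ball 0 1)) M"
  proof -
    have "continuous_on (ball 0 1) g"
      using der by (meson continuous_at_imp_continuous_on has_derivative_continuous)
    then have "closedin (top_of_set (ball 0 1)) {z \<in> ball 0 1. g z = 0}"
      by (rule continuous_closedin_preimage_constant)
    moreover define Z where "Z = {z :: complex ^ 'n. \<forall>j. j \<notin> S \<longrightarrow> z $ j = 0}"
    have "closed Z" unfolding Z_def
      by (intro closed_Collect_all closed_Collect_imp closed_Collect_eq open_Collect_const continuous_intros)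
    then have "closedin (top_of_set (ball 0 1)) (ball 0 1 \<inter> Z)" by (rule closedin_closed_Int)
    ultimately have "closedin (top_of_set (ball 0 1)) ({z \<in> ball 0 1. g z = 0} \<inter> (ball 0 1 \<inter> Z))"
      by (rule closedin_Int)
    moreover have "{z \<in> ball 0 1. g z = 0} \<inter> (ball 0 1 \<inter> Z) = M"
      by (auto simp: M_def Z_def)
    ultimately show ?thesis by simp
  qed
  ultimately show ?thesis by (auto simp: closed_submanifold_of_ball_def M_def)
qed

text \<open>Only the easy case of Sard's theorem is used: the parameters \<open>(w, c)\<close> whose zero set has a
  singular point \<open>z\<close> are determined by \<open>z\<close> and the coordinates of \<open>w\<close> outside \<open>S\<close>, hence
  form the image of a differentiable map from a space of smaller dimension; the variable \<open>u\<close> below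
  stores both. For \<open>w\<close> with a large \<open>i\<^sub>0\<close>-th coordinate the zero set meets the \<open>i\<^sub>0\<close>-th coordinate
  axis by the minimum principle.\<close>

lemma generic_regular_zero_set:
  fixes f :: "complex ^ 'n::finite \<Rightarrow> complex" and D :: "'n \<Rightarrow> complex ^ 'n \<Rightarrow> complex" and S :: "'n set"
  assumes der: "\<And>z. z \<in> ball 0 1 \<Longrightarrow> (f has_derivative (\<lambda>h. \<Sum>i\<in>UNIV. D i z * h $ i)) (at z)"
    and diff: "\<And>i z. z \<in> ball 0 1 \<Longrightarrow> D i differentiable (at z)" and i\<^sub>0: "i\<^sub>0 \<in> S"
  obtains w c where
    "\<exists>z\<in>ball 0 1. (\<forall>j. j \<notin> S \<longrightarrow> z $ j = 0) \<and> f z + (\<Sum>i\<in>UNIV. w $ i * z $ i) + c = 0"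
    "\<And>z. z \<in> ball 0 1 \<Longrightarrow> (\<forall>j. j \<notin> S \<longrightarrow> z $ j = 0) \<Longrightarrow>
      f z + (\<Sum>i\<in>UNIV. w $ i * z $ i) + c = 0 \<Longrightarrow> \<exists>i\<in>S. D i z + w $ i \<noteq> 0"
proof -
  define P where "P u = (\<chi> j. if j \<in> S then u $ j else 0)" for u :: "complex ^ 'n"
  \<comment> \<open>\<open>Q u\<close> is the \<open>w\<close> that makes the derivative at
    \<open>P u\<close> vanish along \<open>S\<close> and agrees with \<open>u\<close> elsewhere; the
    second component of \<open>G u\<close> is the \<open>c\<close> that puts \<open>P u\<close> on
    the zero set.\<close>
  define Q where "Q u = (\<chi> i. if i \<in> S then - D i (P u) else u $ i)" for u
  define G where "G u = (Q u, - f (P u) - (\<Sum>i\<in>UNIV. Q u $ i * P u $ i))" for u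
  define E where "E = {u. P u \<in> ball 0 1}"
  have nth: "(\<lambda>u :: complex ^ 'n. u $ i) differentiable F" for i F
    by (rule bounded_linear_imp_differentiable[OF bounded_linear_vec_nth])
  have vecl: "(\<lambda>u. \<chi> i. h i u) differentiable (at u within T)"
    if hdiff: "\<And>i. h i differentiable (at u within T)" for h :: "'n \<Rightarrow> complex ^ 'n \<Rightarrow> complex" and u T
  proof -
    obtain h' where "\<And>i. (h i has_derivative h' i) (at u within T)"
      using hdiff unfolding differentiable_def by metis
    then show ?thesis unfolding differentiable_def by (blast intro: has_derivative_vec_lambda)
  qed
  have "G differentiable (at u)" if u: "u \<in> E" for u
  proof -
    have P: "P differentiable (at u)"
      unfolding P_def
    proof (rule vecl)
      show "(\<lambda>u. if j \<in> S then u $ j else 0) differentiable (at u)" for j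
        using nth[of j] by (cases "j \<in> S") simp_all
    qed
    have comp: "(\<lambda>u. F (P u)) differentiable (at u)" if "F differentiable (at (P u))" for F :: "complex ^ 'n \<Rightarrow> complex"
      using differentiable_chain_at[OF P that] by (simp add: o_def)
    have Pu: "P u \<in> ball 0 1" using u by (simp add: E_def)
    have f: "f differentiable (at (P u))" using der[OF Pu] by (auto simp: differentiable_def)
    have Qi: "(\<lambda>u. if i \<in> S then - D i (P u) else u $ i) differentiable (at u)" for i
      using comp[OF diff[OF Pu, of i]] nth[of i] by (cases "i \<in> S") auto
    have Pi: "(\<lambda>u. if i \<in> S then u $ i else 0) differentiable (at u)" for i
      using nth[of i] by (cases "i \<in> S") simp_all
    have "Q differentiable (at u)" unfolding Q_def by (rule vecl) (rule Qi)
    moreover have "(\<lambda>u. - f (P u) - (\<Sum>i\<in>UNIV. Q u $ i * P u $ i)) differentiable (at u)"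
      using Qi Pi comp[OF f] by (auto simp: Q_def P_def intro!: derivative_intros)
    ultimately obtain D\<^sub>1 D\<^sub>2 where
      "(Q has_derivative D\<^sub>1) (at u)"
      "((\<lambda>u. - f (P u) - (\<Sum>i\<in>UNIV. Q u $ i * P u $ i)) has_derivative D\<^sub>2) (at u)"
      unfolding differentiable_def by blast
    then have "(G has_derivative (\<lambda>h. (D\<^sub>1 h, D\<^sub>2 h))) (at u)"
      unfolding G_def by (rule has_derivative_Pair)
    then show ?thesis unfolding differentiable_def by blast
  qed
  then have "G differentiable_on E" by (simp add: differentiable_at_imp_differentiable_on)
  \<comment> \<open>The real dimension of the target of \<open>G\<close> exceeds that of its source
    by 2.\<close>
  then have neg: "negligible (G ` E)" by (intro negligible_differentiable_image_lowdim) auto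
  have contf: "continuous_on (ball 0 1) f"
    using der by (meson continuous_at_imp_continuous_on has_derivative_continuous)
  then have "compact (f ` cball 0 (1/2))"
    by (intro compact_continuous_image continuous_on_subset[OF contf]) auto
  then obtain K where K: "\<And>z. z \<in> cball 0 (1/2) \<Longrightarrow> norm (f z) \<le> K"
    by (meson bounded_iff compact_imp_bounded imageI)
  \<comment> \<open>For modulus 1/2 of \<open>\<zeta>\<close> the term
    \<open>w $ i\<^sub>0 * \<zeta>\<close> exceeds \<open>2 * K + 2\<close> in modulus, so the
    restriction to the axis stays above \<open>K + 1\<close>, a bound for its value at 0. Strict
    inequalities make the set open, hence not negligible.\<close>
  define Par where "Par = {x :: (complex ^ 'n) \<times> complex. 4 * K + 4 < norm (fst x $ i\<^sub>0) \<and> norm (snd x) < 1}"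
  have "open Par"
    unfolding Par_def by (intro open_Collect_conj open_Collect_less continuous_intros)
  moreover have "Par \<noteq> {}"
  proof -
    obtain x where "4 * K + 4 < x" using gt_ex by blast
    then have "4 * K + 4 < \<bar>x\<bar>" by linarith
    then have "(axis i\<^sub>0 (of_real x), 0) \<in> Par" by (simp add: Par_def axis_def)
    then show ?thesis by blast
  qed
  ultimately have "\<not> negligible Par" by (rule open_not_negligible)
  then have "\<not> Par \<subseteq> G ` E" using neg negligible_subset by blast
  then obtain w c where wc: "(w, c) \<in> Par" "(w, c) \<notin> G ` E" by auto
  show ?thesis
  proof (rule that[of w c])
    fix z assume z: "z \<in> ball 0 1" and supp: "\<forall>j. j \<notin> S \<longrightarrow> z $ j = 0"
      and zero: "f z + (\<Sum>i\<in>UNIV. w $ i * z $ i) + c = 0"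
    show "\<exists>i\<in>S. D i z + w $ i \<noteq> 0"
    proof (rule ccontr)
      assume "\<not> ?thesis"
      then have crit: "w $ i = - D i z" if "i \<in> S" for i using that by (simp add: eq_neg_iff_add_eq_0 add.commute)
      define u where "u = (\<chi> j. if j \<in> S then z $ j else w $ j)"
      have Pu: "P u = z" using supp by (simp add: P_def u_def vec_eq_iff)
      have Qu: "Q u = w" using crit by (simp add: Q_def Pu vec_eq_iff) (simp add: u_def)
      have "c = - (f z + (\<Sum>i\<in>UNIV. w $ i * z $ i))" using zero by (simp only: add_eq_0_iff)
      then have "G u = (w, c)" by (simp add: G_def Pu Qu)
      moreover have "u \<in> E" using z by (simp add: E_def Pu)
      ultimately show False using wc(2) imageI[of u E G] by simp
    qed
  next
    define h where "h \<zeta> = f (axis i\<^sub>0 \<zeta>) + w $ i\<^sub>0 * \<zeta> + c" for \<zeta>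
    have sum_axis: "(\<Sum>i\<in>UNIV. w $ i * axis i\<^sub>0 \<zeta> $ i) = w $ i\<^sub>0 * \<zeta>" for \<zeta>
      by (simp add: axis_def if_distrib[of "(*) _"] cong: if_cong)
    have dax: "(axis i\<^sub>0 has_derivative axis i\<^sub>0) (at \<zeta>)" for \<zeta> :: complex
      unfolding axis_def[abs_def]
    proof (rule has_derivative_vec_lambda)
      show "((\<lambda>x. if i = i\<^sub>0 then x else 0) has_derivative (\<lambda>h. if i = i\<^sub>0 then h else 0)) (at \<zeta>)" for i
        by (cases "i = i\<^sub>0") simp_all
    qed
    have dh: "(h has_field_derivative (D i\<^sub>0 (axis i\<^sub>0 \<zeta>) + w $ i\<^sub>0)) (at \<zeta>)" if "norm \<zeta> < 1" for \<zeta>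
    proof -
      have "axis i\<^sub>0 \<zeta> \<in> ball 0 1" using that by (simp add: norm_axis)
      from has_derivative_compose[OF dax der[OF this]]
      have "((\<lambda>\<zeta>. f (axis i\<^sub>0 \<zeta>)) has_derivative (\<lambda>x. D i\<^sub>0 (axis i\<^sub>0 \<zeta>) * x)) (at \<zeta>)"
        by (simp add: axis_def if_distrib[of "(*) _"] cong: if_cong)
      then have "((\<lambda>\<zeta>. f (axis i\<^sub>0 \<zeta>)) has_field_derivative D i\<^sub>0 (axis i\<^sub>0 \<zeta>)) (at \<zeta>)"
        by (simp add: has_field_derivative_def)
      then show ?thesis unfolding h_def by (auto intro!: derivative_eq_intros)
    qed
    have large: "4 * K + 4 < norm (w $ i\<^sub>0)" "norm c < 1" using wc(1) by (auto simp: Par_def)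
    have fK: "norm (f (axis i\<^sub>0 \<zeta>)) \<le> K" if "norm \<zeta> \<le> 1/2" for \<zeta>
      using K that by (simp add: norm_axis)
    have hol: "h holomorphic_on ball 0 1"
      unfolding holomorphic_on_def
    proof
      fix \<zeta> :: complex assume "\<zeta> \<in> ball 0 1"
      then have "norm \<zeta> < 1" by simp
      from dh[OF this] show "h field_differentiable at \<zeta> within ball 0 1"
        unfolding field_differentiable_def by (blast intro: has_field_derivative_at_within)
    qed
    obtain \<zeta> where \<zeta>: "\<zeta> \<in> ball 0 (1/2)" "h \<zeta> = 0"
    proof (rule holomorphic_contract_to_zero[of 0 "1/2" h])
      show "h holomorphic_on ball 0 (1/2)" by (rule holomorphic_on_subset[OF hol]) auto
      show "continuous_on (cball 0 (1/2)) h"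
        by (rule continuous_on_subset[OF holomorphic_on_imp_continuous_on[OF hol]]) auto
      fix z :: complex assume "norm (0 - z) = 1/2"
      then have nz: "norm z = 1/2" by simp
      have "norm (h 0) \<le> K + 1"
        unfolding h_def using fK[of 0] large(2) norm_triangle_ineq[of "f (axis i\<^sub>0 0)" c] by simp
      moreover have "norm (w $ i\<^sub>0 * z) \<le> norm (h z) + norm (f (axis i\<^sub>0 z)) + norm c"
      proof -
        have eq: "w $ i\<^sub>0 * z = h z - f (axis i\<^sub>0 z) - c" by (simp add: h_def)
        show ?thesis
          unfolding eq
          using norm_triangle_ineq4[of "h z - f (axis i\<^sub>0 z)" c] norm_triangle_ineq4[of "h z" "f (axis i\<^sub>0 z)"]
          by linarith
      qed
      moreover have "2 * norm (w $ i\<^sub>0 * z) = norm (w $ i\<^sub>0)" using nz by (simp add: norm_mult)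
      moreover have "norm (f (axis i\<^sub>0 z)) \<le> K" using nz by (intro fK) simp
      ultimately show "norm (h 0) < norm (h z)" using large by linarith
    qed auto
    show "\<exists>z\<in>ball 0 1. (\<forall>j. j \<notin> S \<longrightarrow> z $ j = 0) \<and> f z + (\<Sum>i\<in>UNIV. w $ i * z $ i) + c = 0"
    proof (intro bexI[of _ "axis i\<^sub>0 \<zeta>"] conjI)
      show "\<forall>j. j \<notin> S \<longrightarrow> axis i\<^sub>0 \<zeta> $ j = 0" using i\<^sub>0 by (auto simp: axis_def)
      show "f (axis i\<^sub>0 \<zeta>) + (\<Sum>i\<in>UNIV. w $ i * axis i\<^sub>0 \<zeta> $ i) + c = 0"
        using \<zeta>(2) by (simp only: sum_axis h_def)
      show "axis i\<^sub>0 \<zeta> \<in> ball 0 1" using \<zeta>(1) by (simp add: norm_axis)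
    qed
  qed
qed

text \<open>One regular equation on a coordinate subspace of dimension \<open>k + 1\<close> cuts out
  dimension \<open>k\<close>. The zero set of the perturbed function is no level set of
  \<open>f\<close>, but \<open>f\<close> equals the negative of an affine function there and so is
  bounded, which suffices for completeness.\<close>

theorem corollary1p2:
  fixes k :: nat
  assumes "1 \<le> k" and "k < CARD('n::finite)"
  shows "\<exists>M :: (complex ^ 'n) set. closed_submanifold_of_ball k M \<and> complete_in_ball M"
proof -
  obtain S :: "'n set" where S: "card S = Suc k"
    using obtain_subset_with_card_n[of "Suc k" "UNIV :: 'n set"] assms(2) by auto
  then obtain i\<^sub>0 where i\<^sub>0: "i\<^sub>0 \<in> S" by fastforce
  obtain f :: "complex ^ 'n \<Rightarrow> complex" and D where
    der: "\<And>z. z \<in> ball 0 1 \<Longrightarrow> (f has_derivative (\<lambda>h. \<Sum>i\<in>UNIV. D i z * h $ i)) (at z)"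
    and diff: "\<And>i z. z \<in> ball 0 1 \<Longrightarrow> D i differentiable (at z)"
    and long: "\<And>p B. continuous_on {0..<1} p \<Longrightarrow> ((\<lambda>t. norm (p t)) \<longlongrightarrow> 1) (at_left (1::real)) \<Longrightarrow>
        p ` {0..<1} \<subseteq> ball 0 1 \<Longrightarrow>
        (\<forall>t\<in>{0..<1}. norm (f (p t)) \<le> B) \<Longrightarrow> path_length {0..<1} p = \<infinity>"
    by (rule holomorphic_unbounded_on_finite_length_paths) (rule that)
  obtain w c where
    ne: "\<exists>z\<in>ball 0 1. (\<forall>j. j \<notin> S \<longrightarrow> z $ j = 0) \<and> f z + (\<Sum>i\<in>UNIV. w $ i * z $ i) + c = 0"
    and reg: "\<And>z. z \<in> ball 0 1 \<Longrightarrow> (\<forall>j. j \<notin> S \<longrightarrow> z $ j = 0) \<Longrightarrow>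
      f z + (\<Sum>i\<in>UNIV. w $ i * z $ i) + c = 0 \<Longrightarrow> \<exists>i\<in>S. D i z + w $ i \<noteq> 0"
    by (rule generic_regular_zero_set[OF der diff i\<^sub>0]) (assumption, assumption, rule that)
  define g where "g z = f z + (\<Sum>i\<in>UNIV. w $ i * z $ i) + c" for z
  define M where "M = {z \<in> ball 0 1. (\<forall>j. j \<notin> S \<longrightarrow> z $ j = 0) \<and> g z = 0}"
  have "closed_submanifold_of_ball k M"
    unfolding M_def
  proof (rule regular_zero_set_closed_submanifold[where e = "\<lambda>i z. D i z + w $ i"])
    fix z :: "complex ^ 'n" assume z: "z \<in> ball 0 1"
    have "((\<lambda>z. \<Sum>i\<in>UNIV. w $ i * z $ i) has_derivative (\<lambda>h. \<Sum>i\<in>UNIV. w $ i * h $ i)) (at z)"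
      by (intro has_derivative_sum has_derivative_mult_right bounded_linear_imp_has_derivative
          bounded_linear_vec_nth)
    from has_derivative_add[OF has_derivative_add[OF der[OF z] this] has_derivative_const[of c]]
    show "(g has_derivative (\<lambda>h. \<Sum>i\<in>UNIV. (D i z + w $ i) * h $ i)) (at z)"
      by (simp add: g_def[abs_def] distrib_right sum.distrib)
  next
    have "continuous_on (ball 0 1) (D i)" for i
      using diff by (meson continuous_at_imp_continuous_on differentiable_imp_continuous_within)
    then show "continuous_on (ball 0 1) (\<lambda>z. D i z + w $ i)" for i
      by (intro continuous_intros)
  qed (use ne reg S in \<open>auto simp: g_def\<close>)
  moreover have "complete_in_ball M"
    unfolding complete_in_ball_def
  proof (intro allI impI, elim conjE)
    fix p assume p: "continuous_on {0..<1} p" "p ` {0..<1} \<subseteq> M"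
      "((\<lambda>t. norm (p t)) \<longlongrightarrow> 1) (at_left (1::real))"
    have "norm (f z) \<le> (\<Sum>i\<in>UNIV. norm (w $ i)) + norm c" if z: "z \<in> M" for z
    proof -
      have "norm (\<Sum>i\<in>UNIV. w $ i * z $ i) \<le> (\<Sum>i\<in>UNIV. norm (w $ i))"
      proof (rule sum_norm_le)
        fix i
        have "norm (z $ i) \<le> 1"
          using z Finite_Cartesian_Product.norm_nth_le[of z i] by (simp add: M_def)
        then show "norm (w $ i * z $ i) \<le> norm (w $ i)" by (simp add: norm_mult mult_left_le)
      qed
      moreover have "f z + ((\<Sum>i\<in>UNIV. w $ i * z $ i) + c) = 0"
        using z by (simp add: M_def g_def add.assoc)
      then have "f z = - ((\<Sum>i\<in>UNIV. w $ i * z $ i) + c)" by (simp only: eq_neg_iff_add_eq_0)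
      then have "norm (f z) = norm ((\<Sum>i\<in>UNIV. w $ i * z $ i) + c)" by (simp only: norm_minus_cancel)
      ultimately show ?thesis
        using norm_triangle_ineq[of "\<Sum>i\<in>UNIV. w $ i * z $ i" c] by simp
    qed
    then have "\<forall>t\<in>{0..<1}. norm (f (p t)) \<le> (\<Sum>i\<in>UNIV. norm (w $ i)) + norm c"
      using p(2) by blast
    moreover have "p ` {0..<1} \<subseteq> ball 0 1" using p(2) by (auto simp: M_def)
    ultimately show "path_length {0..<1} p = \<infinity>" by (intro long[OF p(1,3)])
  qed
  ultimately show ?thesis by blast
qed

end
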